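(* Let $n=2k\ge4$ be even, let $(W,S)$ be the Weyl group of type $D_n$ with $S=\{s_1,\dots,s_{2k}\}$, and let $I=S\setminus\{s_k,s_{2k}\}$, so that $W_I\cong S_k\times S_k$. Let $U=\{\varepsilon_i+\varepsilon_{j+k}: i,j\in[k]\}$ and write $v_{ij}:=\varepsilon_i+\varepsilon_{j+k}$. Then: (i) $(W,I,U)$ is a QP-triple. (ii) $\Omega_U$ has $k!$ elements, each of the form $R(\pi)=\{v_{1\pi(1)},v_{2\pi(2)},\dots,v_{k\pi(k)}\}$ for some $\pi\in S_k$. (iii) For each $\pi\in S_k$, $\mathrm{Res}_U(R(\pi))=\{v_{ij}: i,j\in[k],\ \pi(i)>j,\ \pi^{-1}(j)>i\}$. (iv) The set $\{(i,j): v_{ij}\in\mathrm{Res}_U(R(\pi))\}$ is the Rothe diagram $D(\pi)$ of $\pi$. (v) For each $\pi\in S_k$, $\rho_U(R(\pi))=\ell(\pi)$, the length of $\pi$. (vi) $\mathrm{QHf}(U)=\sum_{\pi\in S_k}q^{\ell(\pi)}v_{1\pi(1)}\cdots v_{k\pi(k)}$ is the $q$-permanent of the matrix $A=(v_{ij})$, and $\mathrm{QPf}(U)=\sum_{\pi\in S_k}(-q)^{\ell(\pi)}v_{1\pi(1)}\cdots v_{k\pi(k)}$ is the quantum row permanent of $A$ in the sense of Jing–Zhang (here $v_{ij}$ stands for the indeterminate $x_{v_{ij}}$). (vii) $\mathrm{Hf}(U)=\mathrm{per}(A)$ and $\mathrm{Pf}(U)=\det(A)$. (viii) The Poincaré polynomial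 of $U$ is $\prod_{i=2}^k[i]_q$, and its degrees are $2,3,\dots,k$.
   Context: Root system of type $D_n$: vectors $\{\pm\varepsilon_i\pm\varepsilon_j:1\le i<j\le n\}$ in $\mathbb R^n$ with the dot product $B$; simple roots $\alpha_i=\varepsilon_i-\varepsilon_{i+1}$ ($i<n$), $\alpha_n=\varepsilon_{n-1}+\varepsilon_n$; positive roots $\varepsilon_i\pm\varepsilon_j$ ($i<j$); $s_\alpha(\beta)=\beta-B(\alpha,\beta)\alpha$; $s_i=s_{\alpha_i}$; $W_J=\langle J\rangle$ for $J\subseteq S$. For a root $\alpha$, $|\alpha|$ is the positive root among $\pm\alpha$; the standard action of $W$ on sets $R$ of pairwise orthogonal positive roots is $w\cdot R=\{|w(\alpha)|:\alpha\in R\}$. For $U\subseteq\Phi_+$: $\kappa$ is the maximal size of a pairwise orthogonal subset of $U$, $\Omega_U$ the set of pairwise orthogonal subsets of $U$ of size $\kappa$; for $R\in\Omega_U$, $\mathrm{Res}_U(R)=\{\gamma\in U:s_\beta(\gamma)\text{ is a positive root for all }\beta\in R\}$, $\rho_U(R)=|\mathrm{Res}_U(R)|$. With commuting indeterminates $x_\beta$ ($\beta\in U$), $\mathrm{QHf}(U)=\sum_{R\in\Omega_U}q^{\rho_U(R)}\prod_{\beta\in R}x_\beta$, $\mathrm{QPf}(U)=\mathrm{QHf}(U)|_{q\to-q}$, $\mathrm{Hf}(U)=\mathrm{QHf}(U)|_{q=1}$, $\mathrm{Pf}(U)=\mathrm{QHf}(U)|_{q=-1}$; $PS_U(q)=\sum_{R\in\Omega_U}q^{\rho_U(R)}$,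 and if $PS_U(q)=\prod_{d\in D}[d]_q$ ($[d]_q=1+\dots+q^{d-1}$, $D$ a multiset of integers $\ge 2$) the elements of $D$ are the degrees of $U$. Quasiparabolic sets: for a Coxeter system $(W',S')$ with reflections $T'$, a scaled $W'$-set is a $W'$-set $X$ with $\lambda:X\to\mathbb Z$, $|\lambda(sx)-\lambda(x)|\le1$ for $s\in S'$; it is quasiparabolic if (QP1) $r\in T'$, $\lambda(rx)=\lambda(x)\Rightarrow rx=x$, and (QP2) $r\in T'$, $s\in S'$, $\lambda(rx)>\lambda(x)$, $\lambda(srx)<\lambda(sx)\Rightarrow rx=sx$. $(W,I,U)$ is a QP-triple if $\Omega_U$ is a quasiparabolic $W_I$-set under the restricted standard action with level $\rho_U$. The Rothe diagram of $\pi\in S_k$ is $D(\pi)=\{(i,j)\in[k]^2:\pi(i)>j,\ \pi^{-1}(j)>i\}$. *)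

theory Defs
  imports
    "Jordan_Normal_Form.Determinant"
    "HOL-Algebra.Generated_Groups"
    "HOL-Algebra.Group_Action"
    "HOL-Algebra.Sym_Groups"
    "HOL-Combinatorics.Permutations"
    "HOL-Library.Poly_Mapping"
    "HOL-Library.Multiset"
begin

section \<open>The root system of type \<open>D\<^sub>n\<close> and its Weyl group\<close>

text \<open>
  The space \<open>\<real>\<^sup>n\<close> is \<open>carrier_vec n :: real vec set\<close> and \<open>B\<close> is the dot product \<open>scalar_prod\<close>.
  Library vectors are indexed from 0, so \<open>eps n i\<close> (for \<open>i\<close> in \<open>{1..n}\<close>) shifts the index.
\<close>

definition eps :: "nat \<Rightarrow> nat \<Rightarrow> real vec" where
  "eps n i = unit_vec n (i - 1)"

definition pos_roots :: "nat \<Rightarrow> real vec set" where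
  "pos_roots n =
     {eps n i - eps n j | i j. 1 \<le> i \<and> i < j \<and> j \<le> n} \<union>
     {eps n i + eps n j | i j. 1 \<le> i \<and> i < j \<and> j \<le> n}"

definition simple_root :: "nat \<Rightarrow> nat \<Rightarrow> real vec" where
  "simple_root n i =
     (if i < n then eps n i - eps n (i + 1) else eps n (n - 1) + eps n n)"

text \<open>All roots have \<open>B(\<alpha>, \<alpha>) = 2\<close>, which is why no normalizing denominator occurs.\<close>

definition root_refl :: "real vec \<Rightarrow> real vec \<Rightarrow> real vec" where
  "root_refl \<alpha> \<beta> = \<beta> - (\<alpha> \<bullet> \<beta>) \<cdot>\<^sub>v \<alpha>"

text \<open>
  Group elements are bijections of \<open>\<real>\<^sup>n\<close>. The carrier of \<open>BijGroup\<close> consists of extensional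
  functions, hence the restriction.
\<close>

definition simple_refl :: "nat \<Rightarrow> nat \<Rightarrow> (real vec \<Rightarrow> real vec)" where
  "simple_refl n i = restrict (root_refl (simple_root n i)) (carrier_vec n)"

definition simple_refls :: "nat \<Rightarrow> (real vec \<Rightarrow> real vec) set" where
  "simple_refls n = simple_refl n ` {1..n}"

definition weyl_D :: "nat \<Rightarrow> (real vec \<Rightarrow> real vec) monoid" where
  "weyl_D n = subgroup_generated (BijGroup (carrier_vec n)) (simple_refls n)"

definition parabolic_D :: "nat \<Rightarrow> (real vec \<Rightarrow> real vec) set \<Rightarrow> (real vec \<Rightarrow> real vec) monoid" where
  "parabolic_D n J = subgroup_generated (weyl_D n) J"

text \<open>For a root \<open>\<alpha>\<close>, exactly one of \<open>\<alpha>\<close> and \<open>- \<alpha>\<close> is positive.\<close>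

definition abs_root :: "nat \<Rightarrow> real vec \<Rightarrow> real vec" where
  "abs_root n \<alpha> = (if \<alpha> \<in> pos_roots n then \<alpha> else - \<alpha>)"

definition std_act :: "nat \<Rightarrow> (real vec \<Rightarrow> real vec) \<Rightarrow> real vec set \<Rightarrow> real vec set" where
  "std_act n w R = (\<lambda>\<alpha>. abs_root n (w \<alpha>)) ` R"


section \<open>Maximal orthogonal subsets\<close>

definition orthogonal_set :: "real vec set \<Rightarrow> bool" where
  "orthogonal_set R \<longleftrightarrow> pairwise (\<lambda>\<alpha> \<beta>. \<alpha> \<bullet> \<beta> = 0) R"

definition kappa :: "real vec set \<Rightarrow> nat" where
  "kappa U = Max (card ` {R. R \<subseteq> U \<and> orthogonal_set R})"

definition Omega :: "real vec set \<Rightarrow> real vec set set" where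
  "Omega U = {R. R \<subseteq> U \<and> orthogonal_set R \<and> card R = kappa U}"

definition Res :: "nat \<Rightarrow> real vec set \<Rightarrow> real vec set \<Rightarrow> real vec set" where
  "Res n U R = {\<gamma> \<in> U. \<forall>\<beta>\<in>R. root_refl \<beta> \<gamma> \<in> pos_roots n}"

definition rho :: "nat \<Rightarrow> real vec set \<Rightarrow> real vec set \<Rightarrow> nat" where
  "rho n U R = card (Res n U R)"


section \<open>Quasiparabolic sets\<close>

text \<open>
  In this section \<open>(G, S)\<close> is meant to be a Coxeter system. The conditions themselves only refer to
  the group \<open>G\<close>, the set \<open>S\<close> and its conjugates. Below they are only applied to standard parabolic
  subgroups of the Weyl group.
\<close>

definition reflections :: "('g, 'm) monoid_scheme \<Rightarrow> 'g set \<Rightarrow> 'g set" where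
  "reflections G S = {w \<otimes>\<^bsub>G\<^esub> s \<otimes>\<^bsub>G\<^esub> m_inv G w | w s. w \<in> carrier G \<and> s \<in> S}"

definition scaled_set ::
    "('g, 'm) monoid_scheme \<Rightarrow> 'g set \<Rightarrow> ('g \<Rightarrow> 'x \<Rightarrow> 'x) \<Rightarrow> 'x set \<Rightarrow> ('x \<Rightarrow> int) \<Rightarrow> bool" where
  "scaled_set G S act X lev \<longleftrightarrow>
     group_action G X act \<and>
     (\<forall>s\<in>S. \<forall>x\<in>X. \<bar>lev (act s x) - lev x\<bar> \<le> 1)"

definition quasiparabolic ::
    "('g, 'm) monoid_scheme \<Rightarrow> 'g set \<Rightarrow> ('g \<Rightarrow> 'x \<Rightarrow> 'x) \<Rightarrow> 'x set \<Rightarrow> ('x \<Rightarrow> int) \<Rightarrow> bool" where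
  "quasiparabolic G S act X lev \<longleftrightarrow>
     scaled_set G S act X lev \<and>
     (\<forall>r\<in>reflections G S. \<forall>x\<in>X. lev (act r x) = lev x \<longrightarrow> act r x = x) \<and>
     (\<forall>r\<in>reflections G S. \<forall>s\<in>S. \<forall>x\<in>X.
        lev (act r x) > lev x \<and> lev (act s (act r x)) < lev (act s x) \<longrightarrow> act r x = act s x)"

text \<open>
  \<open>group_action\<close> asks for extensional maps, hence the restriction to \<open>Omega U\<close>. It includes that
  \<open>Omega U\<close> is stable under the action.
\<close>

definition QP_triple :: "nat \<Rightarrow> (real vec \<Rightarrow> real vec) set \<Rightarrow> real vec set \<Rightarrow> bool" where
  "QP_triple n I U \<longleftrightarrow>
     I \<subseteq> simple_refls n \<and> U \<subseteq> pos_roots n \<and>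
     quasiparabolic (parabolic_D n I) I (\<lambda>w. restrict (std_act n w) (Omega U)) (Omega U)
       (\<lambda>R. int (rho n U R))"


section \<open>Hafnians and Pfaffians\<close>

text \<open>
  Polynomials in commuting indeterminates indexed by vectors, with coefficients in \<open>'a\<close>:
  a monomial is a finitely supported exponent function. In the \<open>q\<close>-versions the coefficients are
  integer polynomials in \<open>q\<close>.
\<close>

type_synonym 'a root_poly = "(real vec \<Rightarrow>\<^sub>0 nat) \<Rightarrow>\<^sub>0 'a"

definition xvar :: "real vec \<Rightarrow> 'a::comm_ring_1 root_poly" where
  "xvar \<beta> = Poly_Mapping.single (Poly_Mapping.single \<beta> 1) 1"

definition qvar :: "int poly root_poly" where
  "qvar = Poly_Mapping.single 0 [:0, 1:]"

definition QHf :: "nat \<Rightarrow> real vec set \<Rightarrow> int poly root_poly" where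
  "QHf n U = (\<Sum>R\<in>Omega U. qvar ^ rho n U R * (\<Prod>\<beta>\<in>R. xvar \<beta>))"

definition QPf :: "nat \<Rightarrow> real vec set \<Rightarrow> int poly root_poly" where
  "QPf n U = Poly_Mapping.map (\<lambda>p. pcompose p [:0, -1:]) (QHf n U)"

definition Hf :: "nat \<Rightarrow> real vec set \<Rightarrow> int root_poly" where
  "Hf n U = Poly_Mapping.map (\<lambda>p. poly p 1) (QHf n U)"

definition Pf :: "nat \<Rightarrow> real vec set \<Rightarrow> int root_poly" where
  "Pf n U = Poly_Mapping.map (\<lambda>p. poly p (-1)) (QHf n U)"

definition PS :: "nat \<Rightarrow> real vec set \<Rightarrow> int poly" where
  "PS n U = (\<Sum>R\<in>Omega U. [:0, 1:] ^ rho n U R)"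

definition q_int :: "nat \<Rightarrow> int poly" where
  "q_int d = (\<Sum>i<d. [:0, 1:] ^ i)"

definition is_degrees :: "nat \<Rightarrow> real vec set \<Rightarrow> nat multiset \<Rightarrow> bool" where
  "is_degrees n U D \<longleftrightarrow> (\<forall>d\<in>#D. d \<ge> 2) \<and> PS n U = (\<Prod>d\<in>#D. q_int d)"


section \<open>Permutations and permanents\<close>

definition word_length :: "('g, 'm) monoid_scheme \<Rightarrow> 'g set \<Rightarrow> 'g \<Rightarrow> nat" where
  "word_length G S w =
     (LEAST m. \<exists>ws. set ws \<subseteq> S \<and> length ws = m \<and> foldr (mult G) ws (one G) = w)"

text \<open>The Coxeter length with respect to the adjacent transpositions.\<close>

definition perm_length :: "nat \<Rightarrow> (nat \<Rightarrow> nat) \<Rightarrow> nat" where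
  "perm_length k \<pi> =
     word_length (sym_group k) {Transposition.transpose i (i + 1) | i. 1 \<le> i \<and> i < k} \<pi>"

definition rothe_diagram :: "nat \<Rightarrow> (nat \<Rightarrow> nat) \<Rightarrow> (nat \<times> nat) set" where
  "rothe_diagram k \<pi> = {(i, j). i \<in> {1..k} \<and> j \<in> {1..k} \<and> \<pi> i > j \<and> inv' \<pi> j > i}"

text \<open>Permutations act on \<open>{1..k}\<close>, whereas library matrices are indexed from 0.\<close>

definition q_permanent :: "'a::comm_ring_1 \<Rightarrow> 'a mat \<Rightarrow> 'a" where
  "q_permanent q A =
     (if dim_row A = dim_col A then
        (\<Sum>\<pi> | \<pi> permutes {1..dim_row A}.
           q ^ perm_length (dim_row A) \<pi> * (\<Prod>i = 1..dim_row A. A $$ (i - 1, \<pi> i - 1)))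
      else 0)"

text \<open>
  The quantum row permanent of Jing and Zhang, for matrices with commuting entries (so that the
  order of the factors is immaterial).
\<close>

definition quantum_row_permanent :: "'a::comm_ring_1 \<Rightarrow> 'a mat \<Rightarrow> 'a" where
  "quantum_row_permanent q A =
     (if dim_row A = dim_col A then
        (\<Sum>\<pi> | \<pi> permutes {1..dim_row A}.
           (- q) ^ perm_length (dim_row A) \<pi> * (\<Prod>i = 1..dim_row A. A $$ (i - 1, \<pi> i - 1)))
      else 0)"

definition permanent :: "'a::comm_ring_1 mat \<Rightarrow> 'a" where
  "permanent A =
     (if dim_row A = dim_col A then
        (\<Sum>p | p permutes {0..<dim_row A}. \<Prod>i = 0..<dim_row A. A $$ (i, p i))
      else 0)"


section \<open>The roots \<open>v\<^sub>i\<^sub>j\<close>\<close>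

definition vroot :: "nat \<Rightarrow> nat \<Rightarrow> nat \<Rightarrow> real vec" where
  "vroot k i j = eps (2 * k) i + eps (2 * k) (j + k)"

definition Rset :: "nat \<Rightarrow> (nat \<Rightarrow> nat) \<Rightarrow> real vec set" where
  "Rset k \<pi> = (\<lambda>i. vroot k i (\<pi> i)) ` {1..k}"

definition vmat :: "nat \<Rightarrow> 'a::comm_ring_1 root_poly mat" where
  "vmat k = mat k k (\<lambda>(i, j). xvar (vroot k (i + 1) (j + 1)))"

end

theory Submission
  imports Defs
begin

text \<open>
  Since \<open>B(v\<^sub>i\<^sub>j, v\<^sub>a\<^sub>b) = [i = a] + [j = b]\<close>, orthogonal subsets of \<open>U\<close> are rook placements, and the maximal
  ones are the sets \<open>R(\<pi>)\<close>. Reflecting \<open>v\<^sub>i\<^sub>j\<close> in a root of \<open>R(\<pi>)\<close> in the same row or column leaves a root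
  \<open>\<epsilon>\<^sub>x - \<epsilon>\<^sub>y\<close>, whose sign gives the two inequalities of the Rothe diagram; so the level of \<open>R(\<pi>)\<close>
  is the number of inversions of \<open>\<pi>\<close>, which is its Coxeter length.

  The group \<open>W\<^sub>I\<close> permutes the two blocks of coordinates, and \<open>(\<sigma>, \<tau>)\<close> sends \<open>R(\<pi>)\<close> to
  \<open>R(\<tau>\<pi>\<sigma>\<^sup>-\<^sup>1)\<close>. Hence every reflection of \<open>W\<^sub>I\<close> sends \<open>R(\<pi>)\<close> to some \<open>R(\<pi> (a b))\<close> with \<open>a < b\<close>, and
  the level goes up precisely when \<open>\<pi> a < \<pi> b\<close>. This gives (QP1), and (QP2) because an adjacent
  transposition, on either side, reverses the order of only one pair.
\<close>


section \<open>Inversions\<close>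

text \<open>Claim (i) concerns a group of maps on the space, generated inside another generated
  group of bijections. It is identified with the image of an explicit injective homomorphism
  \<open>block_perm\<close> on S_k x S_k; after that, each condition on levels is a comparison of
  inversion counts. Two facts drive these comparisons: a general transposition changes the count
  strictly, in a direction read off from one pair of values, and an adjacent one changes it by
  exactly one. The former serves (QP1) and (QP2), the latter the scaling condition, the Coxeter
  length and the sign. The count ranges over all natural numbers. A permutation fixes the points
  outside its interval, so no bound k enters, and S_k can be regarded as part of S_{k+1}. This gives
  the Poincare polynomial a simple recursion: inserting the largest value at position k + 1 - m
  creates m inversions.\<close>

definition inversions :: "(nat \<Rightarrow> nat) \<Rightarrow> (nat \<times> nat) set" where
  "inversions \<pi> = {(i, j). i < j \<and> \<pi> j < \<pi> i}"

text \<open>If i were left of the interval, it would be fixed; then \<pi> j < i lies outside as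
  well, so j is fixed too and \<pi> j = j > i, a contradiction. The bound on j is symmetric.\<close>

lemma inversions_subset:
  assumes "\<pi> permutes {m..<n}"
  shows "inversions \<pi> \<subseteq> {m..<n} \<times> {m..<n}"
proof (clarsimp simp: inversions_def)
  fix i j assume "i < j" and less: "\<pi> j < \<pi> i"
  have in_iff: "\<pi> x \<in> {m..<n} \<longleftrightarrow> x \<in> {m..<n}" for x
    using permutes_in_image[OF assms] .
  have fixed: "\<pi> x = x" if "x \<notin> {m..<n}" for x
    using permutes_not_in[OF assms that] .
  have "m \<le> i"
    using fixed[of i] fixed[of j] in_iff[of j] \<open>i < j\<close> less by fastforce
  moreover have "j < n"
    using fixed[of i] fixed[of j] in_iff[of i] \<open>i < j\<close> less by fastforce
  ultimately show "m \<le> i \<and> i < n \<and> m \<le> j \<and> j < n"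
    using \<open>i < j\<close> by simp
qed

lemma finite_inversions: "\<pi> permutes {m..<n} \<Longrightarrow> finite (inversions \<pi>)"
  by (rule finite_subset[OF inversions_subset]) auto

lemma inversions_id: "inversions id = {}" "inversions (\<lambda>x. x) = {}"
  by (auto simp: inversions_def)

text \<open>The inversion \<open>(i, j)\<close> is moved along the transposition whenever that keeps its order, and
  otherwise survives unchanged; \<open>(a, b)\<close> itself is a new inversion.\<close>

lemma card_inversions_transpose:
  assumes "a < b" "\<pi> a < \<pi> b" and fin: "finite (inversions (\<pi> \<circ> transpose a b))"
  shows "card (inversions \<pi>) < card (inversions (\<pi> \<circ> transpose a b))"
proof -
  let ?t = "transpose a b"
  define f where "f = (\<lambda>(i, j). if ?t i < ?t j then (?t i, ?t j) else (i, j))"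
  have inj: "inj_on f (inversions \<pi>)"
  proof (rule inj_onI)
    fix x y assume xy: "x \<in> inversions \<pi>" "y \<in> inversions \<pi>" "f x = f y"
    \<comment> \<open>A moved and an unmoved pair cannot have the same image: \<open>?t\<close>
      would turn the common image back into an increasing pair, whereas unmoved pairs are those
      whose order \<open>?t\<close> does not keep.\<close>
    have *: "transpose a b (transpose a b z) = z" for z by simp
    show "x = y"
      using xy unfolding f_def inversions_def
      by (cases x; cases y) (auto split: if_splits, (metis * order.asym)+)
  qed
  \<comment> \<open>The pairs reversed by \<open>?t\<close> are (a, j) and (i, b) with the other
    index strictly between a and b, where \<pi> a < \<pi> b only widens the gap between the values,
    and (a, b) itself, which is no inversion of \<pi>.\<close>
  have sub: "f ` inversions \<pi> \<subseteq> inversions (\<pi> \<circ> ?t) - {(a, b)}"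
  proof
    fix y assume "y \<in> f ` inversions \<pi>"
    then obtain i j where ij: "i < j" "\<pi> j < \<pi> i" "y = f (i, j)"
      by (auto simp: inversions_def)
    show "y \<in> inversions (\<pi> \<circ> ?t) - {(a, b)}"
      using ij assms(1,2) unfolding f_def inversions_def transpose_def
      by (auto split: if_splits)
  qed
  have ab: "(a, b) \<in> inversions (\<pi> \<circ> ?t)"
    using assms by (simp add: inversions_def)
  have "card (inversions \<pi>) = card (f ` inversions \<pi>)"
    using card_image[OF inj] by simp
  also have "\<dots> \<le> card (inversions (\<pi> \<circ> ?t) - {(a, b)})"
    using sub fin by (intro card_mono) auto
  also have "\<dots> < card (inversions (\<pi> \<circ> ?t))"
    using ab fin by (meson card_Diff1_less)
  finally show ?thesis .
qed

text \<open>Only the upward direction needs counting: swapping twice restores \<pi>, so the same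
  count applied to \<open>\<pi> \<circ> transpose a b\<close> gives the downward one. As \<pi> a and
  \<pi> b differ, the two implications become equivalences.\<close>

lemma card_inversions_transpose_iff:
  assumes "\<pi> permutes {m..<n}" "a < b" "a \<in> {m..<n}" "b \<in> {m..<n}"
  shows "card (inversions \<pi>) < card (inversions (\<pi> \<circ> transpose a b)) \<longleftrightarrow> \<pi> a < \<pi> b"
    and "card (inversions (\<pi> \<circ> transpose a b)) < card (inversions \<pi>) \<longleftrightarrow> \<pi> b < \<pi> a"
proof -
  let ?\<sigma> = "\<pi> \<circ> transpose a b"
  have \<sigma>: "?\<sigma> permutes {m..<n}"
    using assms by (intro permutes_compose permutes_swap_id)
  have up: "card (inversions \<pi>) < card (inversions ?\<sigma>)" if "\<pi> a < \<pi> b"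
    using card_inversions_transpose[OF assms(2) that finite_inversions[OF \<sigma>]] .
  have "?\<sigma> \<circ> transpose a b = \<pi>"
    by (simp add: comp_assoc)
  then have down: "card (inversions ?\<sigma>) < card (inversions \<pi>)" if "\<pi> b < \<pi> a"
    using card_inversions_transpose[OF assms(2), of ?\<sigma>] that finite_inversions[OF assms(1)]
    by simp
  have "\<pi> a \<noteq> \<pi> b"
    using permutes_inj[OF assms(1)] assms(2) by (simp add: inj_eq)
  then show "card (inversions \<pi>) < card (inversions ?\<sigma>) \<longleftrightarrow> \<pi> a < \<pi> b"
    "card (inversions ?\<sigma>) < card (inversions \<pi>) \<longleftrightarrow> \<pi> b < \<pi> a"
    using up down by force+
qed

text \<open>An adjacent transposition keeps the order of every pair of positions except (i, Suc i).
  Moving both positions along it therefore matches all other inversions exactly, and the count grows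
  by one and no more.\<close>

lemma card_inversions_adjacent:
  assumes "\<pi> i < \<pi> (Suc i)" and fin: "finite (inversions \<pi>)"
  shows "card (inversions (\<pi> \<circ> transpose i (Suc i))) = Suc (card (inversions \<pi>))"
proof -
  let ?s = "transpose i (Suc i)"
  have *: "?s a < ?s b" if "a < b" "(a, b) \<noteq> (i, Suc i)" for a b
    using that by (auto simp: transpose_def)
  have "inversions (\<pi> \<circ> ?s) = insert (i, Suc i) (map_prod ?s ?s ` inversions \<pi>)"
  proof (intro equalityI subsetI)
    fix x assume "x \<in> inversions (\<pi> \<circ> ?s)"
    then obtain a b where x: "x = (a, b)" and ab: "a < b" "\<pi> (?s b) < \<pi> (?s a)"
      by (auto simp: inversions_def)
    have "(?s a, ?s b) \<in> inversions \<pi>" if "x \<noteq> (i, Suc i)"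
      using * ab that x by (auto simp: inversions_def)
    then show "x \<in> insert (i, Suc i) (map_prod ?s ?s ` inversions \<pi>)"
      unfolding x by (force intro: rev_image_eqI)
  next
    fix x assume "x \<in> insert (i, Suc i) (map_prod ?s ?s ` inversions \<pi>)"
    then show "x \<in> inversions (\<pi> \<circ> ?s)"
      using assms(1) by (auto simp: inversions_def intro!: *)
  qed
  moreover have "(i, Suc i) \<notin> map_prod ?s ?s ` inversions \<pi>"
    by (auto simp: inversions_def transpose_def split: if_splits)
  moreover have "inj_on (map_prod ?s ?s) (inversions \<pi>)"
    by (intro inj_onI) (auto simp: transpose_eq_iff)
  ultimately show ?thesis
    using fin by (simp add: card_image)
qed

lemma card_inversions_adjacent_cases:
  assumes "\<pi> permutes {m..<n}" "m \<le> i" "Suc i < n"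
  shows "card (inversions (\<pi> \<circ> transpose i (Suc i))) = Suc (card (inversions \<pi>)) \<or>
    card (inversions \<pi>) = Suc (card (inversions (\<pi> \<circ> transpose i (Suc i))))"
proof -
  let ?\<sigma> = "\<pi> \<circ> transpose i (Suc i)"
  have \<sigma>: "?\<sigma> permutes {m..<n}"
    using assms by (intro permutes_compose permutes_swap_id) auto
  have "\<pi> i \<noteq> \<pi> (Suc i)"
    using permutes_inj[OF assms(1)] by (simp add: inj_eq)
  moreover have "?\<sigma> \<circ> transpose i (Suc i) = \<pi>"
    by (simp add: comp_assoc)
  ultimately show ?thesis
    using card_inversions_adjacent[of \<pi> i] card_inversions_adjacent[of ?\<sigma> i]
      finite_inversions[OF \<sigma>] finite_inversions[OF assms(1)]
    by (cases "\<pi> i < \<pi> (Suc i)") auto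
qed

text \<open>Carries counts for right multiplication over to left multiplication: the inverse has the
  values of an inversion, in reverse order, as its own inversion.\<close>

lemma card_inversions_inv:
  assumes "\<pi> permutes S"
  shows "card (inversions (inv' \<pi>)) = card (inversions \<pi>)"
proof -
  have "bij_betw (\<lambda>(i, j). (\<pi> j, \<pi> i)) (inversions \<pi>) (inversions (inv' \<pi>))"
    by (rule bij_betw_byWitness[where f' = "\<lambda>(i, j). (inv' \<pi> j, inv' \<pi> i)"])
      (auto simp: inversions_def permutes_inverses[OF assms])
  then show ?thesis
    by (simp add: bij_betw_same_card)
qed

text \<open>Without a descent \<pi> is strictly increasing on all natural numbers, and so is its
  inverse. Neither can then lower any number, which forces \<pi> = id. A descent is an inversion and
  hence lies in the interval.\<close>

lemma exists_descent:
  assumes "\<pi> permutes {m..<n}" "\<pi> \<noteq> id"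
  obtains i where "m \<le> i" "Suc i < n" "\<pi> (Suc i) < \<pi> i"
proof -
  have "\<exists>i. \<pi> (Suc i) < \<pi> i"
  proof (rule ccontr)
    assume "\<nexists>i. \<pi> (Suc i) < \<pi> i"
    moreover have "\<pi> i \<noteq> \<pi> (Suc i)" for i
      using permutes_inj[OF assms(1)] by (simp add: inj_eq)
    ultimately have mono: "strict_mono \<pi>"
      by (simp add: strict_mono_Suc_iff) (metis nat_neq_iff)
    have "strict_mono (inv' \<pi>)"
      using mono permutes_inverses[OF assms(1)]
      by (intro strict_monoI) (metis strict_mono_less)
    then have "\<pi> x = x" for x
      using strict_mono_imp_increasing[OF mono] strict_mono_imp_increasing[of "inv' \<pi>" "\<pi> x"]
        permutes_inverses[OF assms(1)]
      by (simp add: order_antisym)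
    with assms(2) show False by auto
  qed
  then obtain i where i: "\<pi> (Suc i) < \<pi> i" ..
  then have "(i, Suc i) \<in> inversions \<pi>"
    by (simp add: inversions_def)
  with inversions_subset[OF assms(1)] i that show ?thesis
    by auto
qed

text \<open>Sorting by descents: swapping at a descent lowers the number of inversions until the
  identity is reached. The step assumes an ascent so that each factor adds exactly one inversion,
  which the sign and the length rely on.\<close>

lemma permutes_adjacent_induct [consumes 1, case_names id step]:
  assumes "\<pi> permutes {m..<n}"
    and id: "P id"
    and step: "\<And>\<pi> i. \<lbrakk>\<pi> permutes {m..<n}; m \<le> i; Suc i < n; \<pi> i < \<pi> (Suc i); P \<pi>\<rbrakk>
      \<Longrightarrow> P (\<pi> \<circ> transpose i (Suc i))"
  shows "P \<pi>"
  using assms(1)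
proof (induction "card (inversions \<pi>)" arbitrary: \<pi> rule: less_induct)
  case less
  show ?case
  proof (cases "\<pi> = id")
    case True
    then show ?thesis using id by simp
  next
    case False
    then obtain i where i: "m \<le> i" "Suc i < n" "\<pi> (Suc i) < \<pi> i"
      using exists_descent[OF less.prems] by blast
    let ?\<sigma> = "\<pi> \<circ> transpose i (Suc i)"
    have \<sigma>: "?\<sigma> permutes {m..<n}"
      using less.prems i by (intro permutes_compose permutes_swap_id) auto
    have "card (inversions ?\<sigma>) < card (inversions \<pi>)"
      using card_inversions_transpose_iff(2)[OF less.prems, of i "Suc i"] i by simp
    then have "P ?\<sigma>"
      using less.hyps \<sigma> by blast
    then have "P (?\<sigma> \<circ> transpose i (Suc i))"
      using step[OF \<sigma>] i by simp
    then show ?thesis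
      by (simp add: comp_assoc)
  qed
qed

section \<open>Sign, Coxeter length and Rothe diagram in terms of inversions\<close>

lemma sign_eq_inversions:
  assumes "\<pi> permutes {m..<n}"
  shows "sign \<pi> = (- 1) ^ card (inversions \<pi>)"
  using assms
proof (induction rule: permutes_adjacent_induct)
  case id
  show "sign id = (- 1) ^ card (inversions id)" by (simp add: inversions_id)
next
  case (step \<pi> i)
  have "permutation \<pi>"
    using step.hyps(1) by (rule permutes_imp_permutation[OF finite_atLeastLessThan])
  with step show "sign (\<pi> \<circ> transpose i (Suc i)) =
      (- 1) ^ card (inversions (\<pi> \<circ> transpose i (Suc i)))"
    by (simp add: sign_compose permutation_swap_id sign_swap_id
      card_inversions_adjacent finite_inversions[OF step.hyps(1)])
qed

lemma foldr_comp_eq: "foldr (\<circ>) ws f = foldr (\<circ>) ws id \<circ> f"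
  by (induction ws) (auto simp: comp_assoc)

definition adjacent_transpositions :: "nat \<Rightarrow> (nat \<Rightarrow> nat) set" where
  "adjacent_transpositions k = {transpose i (i + 1) | i. 1 \<le> i \<and> i < k}"

lemma exists_adjacent_word:
  assumes "\<pi> permutes {1..k}"
  shows "\<exists>ws. set ws \<subseteq> adjacent_transpositions k \<and> length ws = card (inversions \<pi>) \<and>
    foldr (\<circ>) ws id = \<pi>"
  using assms unfolding atLeastLessThanSuc_atLeastAtMost[symmetric]
proof (induction rule: permutes_adjacent_induct)
  case id
  have "length [] = card (inversions id)" "foldr (\<circ>) [] id = id"
    by (simp_all add: inversions_id)
  then show ?case by (intro exI[of _ "[]"]) (auto simp: inversions_id)
next
  case (step \<pi> i)
  then obtain ws where ws: "set ws \<subseteq> adjacent_transpositions k"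
    "length ws = card (inversions \<pi>)" "foldr (\<circ>) ws id = \<pi>" by blast
  have "transpose i (Suc i) \<in> adjacent_transpositions k"
    using step unfolding adjacent_transpositions_def by auto
  moreover have "foldr (\<circ>) (ws @ [transpose i (Suc i)]) id = \<pi> \<circ> transpose i (Suc i)"
    using foldr_comp_eq[of ws "transpose i (Suc i)"] ws(3) by simp
  moreover have "length (ws @ [transpose i (Suc i)]) =
      card (inversions (\<pi> \<circ> transpose i (Suc i)))"
    using ws card_inversions_adjacent[OF step.hyps(4) finite_inversions[OF step.hyps(1)]] by simp
  moreover have "set (ws @ [transpose i (Suc i)]) \<subseteq> adjacent_transpositions k"
    using ws calculation by simp
  ultimately show ?case
    by blast
qed

text \<open>The lower bound for the length: each letter changes the count by one, so m letters
  create at most m inversions. The induction removes the last letter because the counts above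
  concern right multiplication.\<close>

lemma card_inversions_adjacent_word:
  assumes "set ws \<subseteq> adjacent_transpositions k"
  shows "foldr (\<circ>) ws id permutes {1..k} \<and> card (inversions (foldr (\<circ>) ws id)) \<le> length ws"
  using assms
proof (induction ws rule: rev_induct)
  case Nil
  have "foldr (\<circ>) [] id permutes {1..k} \<and> card (inversions (foldr (\<circ>) [] id)) \<le> length []"
    by (simp add: inversions_id permutes_id)
  then show ?case .
next
  case (snoc s ws)
  let ?\<pi> = "foldr (\<circ>) ws id"
  from snoc obtain i where i: "s = transpose i (Suc i)" "1 \<le> i" "i < k"
    by (auto simp: adjacent_transpositions_def)
  have "set ws \<subseteq> adjacent_transpositions k"
    using snoc.prems by simp
  from snoc.IH[OF this] have IH: "?\<pi> permutes {1..k}" "card (inversions ?\<pi>) \<le> length ws"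
    by blast+
  have eq: "foldr (\<circ>) (ws @ [s]) id = ?\<pi> \<circ> s"
    using foldr_comp_eq[of ws s] by simp
  have "s permutes {1..k}"
    using i by (auto intro: permutes_swap_id)
  then have "foldr (\<circ>) (ws @ [s]) id permutes {1..k}"
    unfolding eq using IH(1) by (intro permutes_compose)
  moreover have "card (inversions (?\<pi> \<circ> s)) \<le> Suc (card (inversions ?\<pi>))"
    using card_inversions_adjacent_cases[of ?\<pi> 1 "Suc k" i] IH(1) i
    by (auto simp: atLeastLessThanSuc_atLeastAtMost)
  then have "card (inversions (foldr (\<circ>) (ws @ [s]) id)) \<le> length (ws @ [s])"
    using IH(2) eq by simp
  ultimately show ?case ..
qed

lemma perm_length_eq_inversions:
  assumes "\<pi> permutes {1..k}"
  shows "perm_length k \<pi> = card (inversions \<pi>)"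
  unfolding perm_length_def word_length_def sym_group_mult sym_group_one
    adjacent_transpositions_def[symmetric]
proof (rule Least_equality)
  show "\<exists>ws. set ws \<subseteq> adjacent_transpositions k \<and> length ws = card (inversions \<pi>) \<and>
      foldr (\<circ>) ws id = \<pi>"
    using exists_adjacent_word[OF assms] .
qed (use card_inversions_adjacent_word in blast)

text \<open>A cell (i, c) of the diagram encodes the inversion formed by position i and the position
  of the value c.\<close>

lemma card_rothe_diagram:
  assumes "\<pi> permutes {1..k}"
  shows "card (rothe_diagram k \<pi>) = card (inversions \<pi>)"
proof -
  have sub: "inversions \<pi> \<subseteq> {1..k} \<times> {1..k}"
    using inversions_subset[of \<pi> 1 "Suc k"] assms
    by (simp add: atLeastLessThanSuc_atLeastAtMost)
  have in_iff: "\<pi> x \<in> {1..k} \<longleftrightarrow> x \<in> {1..k}" "inv' \<pi> x \<in> {1..k} \<longleftrightarrow> x \<in> {1..k}" for x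
    using permutes_in_image[OF assms] permutes_in_image[OF permutes_inv[OF assms]] by auto
  have "bij_betw (\<lambda>(i, j). (i, \<pi> j)) (inversions \<pi>) (rothe_diagram k \<pi>)"
  proof (rule bij_betw_byWitness[where f' = "\<lambda>(i, j). (i, inv' \<pi> j)"])
    show "(\<lambda>(i, j). (i, \<pi> j)) ` inversions \<pi> \<subseteq> rothe_diagram k \<pi>"
      using sub in_iff by (fastforce simp: inversions_def rothe_diagram_def permutes_inverses[OF assms])
  qed (auto simp: inversions_def rothe_diagram_def permutes_inverses[OF assms])
  then show ?thesis
    by (simp add: bij_betw_same_card)
qed

section \<open>The generating function of inversions\<close>

text \<open>The cycle that moves \<open>p + m\<close> to position \<open>p\<close>, as a product of adjacent transpositions: composing
  a permutation of \<open>{1..p + m - 1}\<close> with it creates one inversion per factor.\<close>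

fun down_cycle :: "nat \<Rightarrow> nat \<Rightarrow> nat \<Rightarrow> nat" where
  "down_cycle p 0 = id"
| "down_cycle p (Suc m) = down_cycle (Suc p) m \<circ> transpose p (Suc p)"

lemma down_cycle_permutes: "1 \<le> p \<Longrightarrow> down_cycle p m permutes {1..p + m}"
proof (induction m arbitrary: p)
  case 0
  show "down_cycle p 0 permutes {1..p + 0}" by (simp add: permutes_id)
next
  case (Suc m)
  have "down_cycle (Suc p) m permutes {1..p + Suc m}"
    using Suc.IH[of "Suc p"] Suc.prems by simp
  moreover have "transpose p (Suc p) permutes {1..p + Suc m}"
    using Suc.prems by (intro permutes_swap_id) auto
  ultimately show ?case
    unfolding down_cycle.simps by (intro permutes_compose)
qed

lemma down_cycle_below: "x < p \<Longrightarrow> down_cycle p m x = x"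
  by (induction m arbitrary: p) auto

lemma down_cycle_apply: "down_cycle p m p = p + m"
  by (induction m arbitrary: p) auto

lemma card_inversions_down_cycle:
  assumes "\<pi> permutes {1..k}" "1 \<le> p" "p + m = Suc k"
  shows "card (inversions (\<pi> \<circ> down_cycle p m)) = card (inversions \<pi>) + m"
  using assms(2,3)
proof (induction m arbitrary: p)
  case 0
  show ?case by simp
next
  case (Suc m)
  let ?\<sigma> = "\<pi> \<circ> down_cycle (Suc p) m"
  have IH: "card (inversions ?\<sigma>) = card (inversions \<pi>) + m"
    using Suc.IH[of "Suc p"] Suc.prems by (simp add: o_def)
  have "\<pi> p \<in> {1..k}"
    using Suc.prems permutes_in_image[OF assms(1), of p] by simp
  \<comment> \<open>The largest value \<open>Suc k\<close> has so far been brought to position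
    \<open>Suc p\<close>, so the next factor acts at an ascent.\<close>
  moreover have "?\<sigma> p = \<pi> p" "?\<sigma> (Suc p) = Suc k"
    using Suc.prems permutes_not_in[OF assms(1), of "Suc k"]
    by (simp_all add: down_cycle_below down_cycle_apply)
  ultimately have less: "?\<sigma> p < ?\<sigma> (Suc p)"
    by simp
  have "\<pi> permutes {1..Suc k}"
    by (rule permutes_subset[OF assms(1)]) auto
  moreover have "down_cycle (Suc p) m permutes {1..Suc k}"
    using down_cycle_permutes[of "Suc p" m] Suc.prems by simp
  ultimately have "?\<sigma> permutes {1..<Suc (Suc k)}"
    unfolding atLeastLessThanSuc_atLeastAtMost by (intro permutes_compose)
  from card_inversions_adjacent[OF less finite_inversions[OF this]] IH show ?case
    by (simp add: o_def)
qed

text \<open>A permutation of {1..Suc k} is determined by the position Suc k - m of its largest value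
  and by a permutation of {1..k}. The cycle that creates this position adds m inversions, so the sum
  factors.\<close>

lemma sum_inversions_Suc:
  fixes x :: "'a::comm_semiring_1"
  shows "(\<Sum>\<pi> | \<pi> permutes {1..Suc k}. x ^ card (inversions \<pi>)) =
    (\<Sum>\<pi> | \<pi> permutes {1..k}. x ^ card (inversions \<pi>)) * (\<Sum>m<Suc k. x ^ m)"
proof -
  let ?A = "{\<pi>. \<pi> permutes {1..k}} \<times> {..<Suc k}"
  let ?B = "{\<pi>. \<pi> permutes {1..Suc k}}"
  define f :: "(nat \<Rightarrow> nat) \<times> nat \<Rightarrow> nat \<Rightarrow> nat" where "f = (\<lambda>(\<pi>, m). \<pi> \<circ> down_cycle (Suc k - m) m)"
  have cycle: "down_cycle (Suc k - m) m permutes {1..Suc k}" if "m < Suc k" for m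
    using down_cycle_permutes[of "Suc k - m" m] that by simp
  have apply_f: "f (\<pi>, m) x = Suc k \<longleftrightarrow> x = Suc k - m"
    if "\<pi> permutes {1..k}" "m < Suc k" for \<pi> m x
  proof -
    have "f (\<pi>, m) (Suc k - m) = Suc k"
      using that permutes_not_in[OF that(1), of "Suc k"] by (simp add: f_def down_cycle_apply)
    moreover have "inj (f (\<pi>, m))"
      unfolding f_def using permutes_inj[OF that(1)] permutes_inj[OF cycle[OF that(2)]]
      by (simp add: inj_compose)
    ultimately show ?thesis
      by (metis inj_eq)
  qed
  have inj: "inj_on f ?A"
  proof (rule inj_onI, clarsimp)
    fix \<pi> m \<sigma> l
    assume *: "\<pi> permutes {Suc 0..k}" "m < Suc k" "\<sigma> permutes {Suc 0..k}" "l < Suc k"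
      "f (\<pi>, m) = f (\<sigma>, l)"
    then have "Suc k - m = Suc k - l"
      using apply_f[of \<pi> m "Suc k - m"] apply_f[of \<sigma> l "Suc k - m"] by simp
    then have "m = l"
      using * by linarith
    moreover from this have "\<pi> = \<sigma>"
      using *(5) permutes_surj[OF cycle[OF *(2)]] unfolding f_def
      by (auto simp: fun_eq_iff surj_def) metis
    ultimately show "\<pi> = \<sigma> \<and> m = l" by simp
  qed
  have "f ` ?A \<subseteq> ?B"
    using cycle permutes_subset[of _ "{1..k}" "{1..Suc k}"]
    by (auto simp: f_def intro!: permutes_compose)
  \<comment> \<open>Surjectivity comes from counting, k! (k + 1) = (k + 1)!, instead of an explicit
    inverse.\<close>
  moreover have "card ?A = card ?B"
    by (simp add: card_cartesian_product card_permutations[of _ k] card_permutations[of _ "Suc k"])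
  ultimately have image: "f ` ?A = ?B"
    using card_image[OF inj] by (intro card_subset_eq) (auto simp: finite_permutations)
  have "(\<Sum>\<pi>\<in>?B. x ^ card (inversions \<pi>)) = (\<Sum>a\<in>?A. x ^ card (inversions (f a)))"
    using sum.reindex[OF inj, of "\<lambda>\<pi>. x ^ card (inversions \<pi>)"] image by (simp add: o_def)
  also have "\<dots> = (\<Sum>(\<pi>, m)\<in>?A. x ^ card (inversions \<pi>) * x ^ m)"
  proof (rule sum.cong[OF refl], clarify)
    fix \<pi> m assume "\<pi> permutes {1..k}" "m < Suc k"
    then show "x ^ card (inversions (f (\<pi>, m))) = x ^ card (inversions \<pi>) * x ^ m"
      using card_inversions_down_cycle[of \<pi> k "Suc k - m" m] by (simp add: f_def power_add)
  qed
  also have "\<dots> = (\<Sum>\<pi> | \<pi> permutes {1..k}. x ^ card (inversions \<pi>)) * (\<Sum>m<Suc k. x ^ m)"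
    by (simp only: sum_product sum.cartesian_product)
  finally show ?thesis .
qed

lemma sum_inversions:
  "(\<Sum>\<pi> | \<pi> permutes {1..k}. [:0, 1:] ^ card (inversions \<pi>)) = (\<Prod>i = 2..k. q_int i)"
proof (induction k)
  case 0
  show ?case by (simp add: permutes_empty inversions_id[unfolded id_def] inversions_id)
next
  case (Suc k)
  have "(\<Sum>\<pi> | \<pi> permutes {1..Suc k}. [:0, 1:] ^ card (inversions \<pi>)) =
      (\<Prod>i = 2..k. q_int i) * q_int (Suc k)"
    unfolding sum_inversions_Suc Suc.IH q_int_def ..
  also have "\<dots> = (\<Prod>i = 2..Suc k. q_int i)"
    \<comment> \<open>For k = 0 the new factor is \<open>q_int 1\<close> = 1, while the product over
      {2..1} is empty.\<close>
    by (cases "k = 0") (simp_all add: q_int_def prod.nat_ivl_Suc')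
  finally show ?case .
qed

section \<open>From permutations of {0..<k} to permutations of {1..k}\<close>

lemma bij_betw_map_permutation_Suc:
  "bij_betw (map_permutation {0..<k} Suc) {p. p permutes {0..<k}} {p. p permutes {1..k}}"
proof (rule bij_betw_byWitness[where f' = "map_permutation {1..k} (\<lambda>i. i - 1)"])
  have up: "bij_betw Suc {0..<k} {1..k}"
    by (rule bij_betw_byWitness[where f' = "\<lambda>i. i - 1"]) auto
  have down: "bij_betw (\<lambda>i. i - 1) {1..k} {0..<k}"
    by (rule bij_betw_byWitness[where f' = Suc]) auto
  show "\<forall>p\<in>{p. p permutes {0..<k}}.
      map_permutation {1..k} (\<lambda>i. i - 1) (map_permutation {0..<k} Suc p) = p"
    using map_permutation_compose_inv[OF up] by simp
  show "\<forall>p\<in>{p. p permutes {1..k}}.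
      map_permutation {0..<k} Suc (map_permutation {1..k} (\<lambda>i. i - 1) p) = p"
    using map_permutation_compose_inv[OF down] by simp
  show "map_permutation {0..<k} Suc ` {p. p permutes {0..<k}} \<subseteq> {p. p permutes {1..k}}"
    using map_permutation_permutes[OF up] by blast
  show "map_permutation {1..k} (\<lambda>i. i - 1) ` {p. p permutes {1..k}} \<subseteq> {p. p permutes {0..<k}}"
    using map_permutation_permutes[OF down] by blast
qed

text \<open>The parameter F lets one reindexing serve both the permanent, where the sign is ignored,
  and the determinant, where it is a factor. Conjugation by \<open>Suc\<close> preserves
  signs.\<close>

lemma sum_permutes_shift:
  fixes a :: "nat \<Rightarrow> nat \<Rightarrow> 'a::comm_monoid_mult" and F :: "int \<Rightarrow> 'a \<Rightarrow> 'b::comm_monoid_add"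
  shows "(\<Sum>p | p permutes {0..<k}. F (sign p) (\<Prod>i = 0..<k. a (Suc i) (Suc (p i)))) =
    (\<Sum>\<pi> | \<pi> permutes {1..k}. F (sign \<pi>) (\<Prod>i = 1..k. a i (\<pi> i)))"
proof -
  let ?m = "map_permutation {0..<k} Suc"
  have inj: "inj_on Suc {0..<k}" by simp
  have "(\<Sum>\<pi> | \<pi> permutes {1..k}. F (sign \<pi>) (\<Prod>i = 1..k. a i (\<pi> i))) =
      (\<Sum>p | p permutes {0..<k}. F (sign (?m p)) (\<Prod>i = 1..k. a i (?m p i)))"
    by (rule sum.reindex_bij_betw[OF bij_betw_map_permutation_Suc, symmetric])
  also have "\<dots> = (\<Sum>p | p permutes {0..<k}. F (sign p) (\<Prod>i = 0..<k. a (Suc i) (Suc (p i))))"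
  proof (rule sum.cong[OF refl], clarify)
    fix p assume p: "p permutes {0..<k}"
    have "(\<Prod>i = 1..k. a i (?m p i)) = (\<Prod>i = 0..<k. a (Suc i) (?m p (Suc i)))"
      using prod.shift_bounds_Suc_ivl[of "\<lambda>i. a i (?m p i)" 0 k]
      by (simp add: atLeastLessThanSuc_atLeastAtMost)
    also have "\<dots> = (\<Prod>i = 0..<k. a (Suc i) (Suc (p i)))"
      by (intro prod.cong refl) (simp add: map_permutation_apply)
    finally show "F (sign (?m p)) (\<Prod>i = 1..k. a i (?m p i)) =
        F (sign p) (\<Prod>i = 0..<k. a (Suc i) (Suc (p i)))"
      using sign_map_permutation[OF inj p] by simp
  qed
  finally show ?thesis ..
qed


section \<open>Maximal orthogonal sets of roots\<close>

lemma eps_carrier [simp]: "eps n i \<in> carrier_vec n"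
  by (simp add: eps_def)

lemma eps_scalar_prod:
  assumes "i \<in> {1..n}" "j \<in> {1..n}"
  shows "eps n i \<bullet> eps n j = (if i = j then 1 else 0)"
  using assms by (auto simp: eps_def)

text \<open>A linear form with the decreasing positive values n, ..., 1 on the basis vectors, hence
  positive on all positive roots; it is the usual height plus the sum of the coordinates. It
  certifies that a vector is not a positive root.\<close>

definition height :: "nat \<Rightarrow> real vec \<Rightarrow> real" where
  "height n v = vec n (\<lambda>m. real (n - m)) \<bullet> v"

lemma height_eps: "i \<in> {1..n} \<Longrightarrow> height n (eps n i) = real (n + 1 - i)"
  by (auto simp: height_def eps_def Suc_diff_le)

lemma height_add:
  "v \<in> carrier_vec n \<Longrightarrow> w \<in> carrier_vec n \<Longrightarrow> height n (v + w) = height n v + height n w"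
  by (simp add: height_def scalar_prod_add_distrib[of _ n])

lemma height_minus:
  "v \<in> carrier_vec n \<Longrightarrow> w \<in> carrier_vec n \<Longrightarrow> height n (v - w) = height n v - height n w"
  by (simp add: height_def scalar_prod_minus_distrib[of _ n])

lemma height_uminus: "v \<in> carrier_vec n \<Longrightarrow> height n (- v) = - height n v"
  by (simp add: height_def)

lemma height_pos: "\<alpha> \<in> pos_roots n \<Longrightarrow> 0 < height n \<alpha>"
  by (auto simp: pos_roots_def height_add height_minus height_eps)

lemma eps_minus_eps_pos_roots:
  assumes "i \<in> {1..n}" "j \<in> {1..n}" "i \<noteq> j"
  shows "eps n i - eps n j \<in> pos_roots n \<longleftrightarrow> i < j"
proof
  assume "eps n i - eps n j \<in> pos_roots n"
  from height_pos[OF this] show "i < j"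
    using assms by (simp add: height_minus height_eps)
qed (use assms in \<open>auto simp: pos_roots_def\<close>)

lemma vroot_carrier [simp]: "vroot k i j \<in> carrier_vec (2 * k)"
  by (simp add: vroot_def)

lemma dim_vroot [simp]: "dim_vec (vroot k i j) = 2 * k"
  using vroot_carrier by (rule carrier_vecD)

lemma vroot_pos_roots:
  assumes "i \<in> {1..k}" "j \<in> {1..k}"
  shows "vroot k i j \<in> pos_roots (2 * k)"
proof -
  have "1 \<le> i \<and> i < j + k \<and> j + k \<le> 2 * k"
    using assms by auto
  then show ?thesis
    unfolding pos_roots_def vroot_def by blast
qed

lemma vroot_scalar_prod:
  assumes "i \<in> {1..k}" "j \<in> {1..k}" "a \<in> {1..k}" "b \<in> {1..k}"
  shows "vroot k i j \<bullet> vroot k a b = (if i = a then 1 else 0) + (if j = b then 1 else 0)"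
  using assms unfolding vroot_def
  by (simp add: scalar_prod_add_distrib[of _ "2 * k"] add_scalar_prod_distrib[of _ "2 * k"]
      eps_scalar_prod)

text \<open>Each of these roots has product 2 with itself, while index pairs that differ give a
  product of at most 1.\<close>

lemma vroot_inject:
  assumes "i \<in> {1..k}" "j \<in> {1..k}" "a \<in> {1..k}" "b \<in> {1..k}"
  shows "vroot k i j = vroot k a b \<longleftrightarrow> i = a \<and> j = b"
proof
  assume "vroot k i j = vroot k a b"
  then have "vroot k i j \<bullet> vroot k i j = vroot k i j \<bullet> vroot k a b"
    by simp
  then show "i = a \<and> j = b"
    using assms by (auto simp: vroot_scalar_prod split: if_splits)
qed simp

text \<open>The two implications also cover the extreme cases: a root sharing neither index is
  orthogonal and leaves \<open>vroot k i j\<close> fixed, so both hold vacuously; reflecting the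
  root in itself negates it, and they demand the impossible j < j and i < i.\<close>

lemma root_refl_vroot_pos_iff:
  assumes "i \<in> {1..k}" "j \<in> {1..k}" "a \<in> {1..k}" "b \<in> {1..k}"
  shows "root_refl (vroot k a b) (vroot k i j) \<in> pos_roots (2 * k) \<longleftrightarrow>
    (i = a \<longrightarrow> j < b) \<and> (j = b \<longrightarrow> i < a)"
proof -
  have minus: "vroot k i j - vroot k a b = (eps (2 * k) i - eps (2 * k) a) +
      (eps (2 * k) (j + k) - eps (2 * k) (b + k))"
    unfolding vroot_def by (intro eq_vecI) (auto simp: eps_def)
  have eps0: "eps (2 * k) x - eps (2 * k) x = 0\<^sub>v (2 * k)" for x
    by (intro eq_vecI) (auto simp: eps_def)
  consider "i = a" "j = b" | "i = a" "j \<noteq> b" | "i \<noteq> a" "j = b" | "i \<noteq> a" "j \<noteq> b"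
    by blast
  then show ?thesis
  proof cases
    case 1
    have "root_refl (vroot k a b) (vroot k i j) = - vroot k a b"
      using assms 1 unfolding root_refl_def
      by (intro eq_vecI) (auto simp: vroot_scalar_prod)
    moreover have "- vroot k a b \<notin> pos_roots (2 * k)"
      using height_pos[OF vroot_pos_roots[of a k b]] height_pos[of "- vroot k a b" "2 * k"] assms
      by (auto simp: height_uminus)
    ultimately show ?thesis
      using 1 by simp
  next
    case 2
    then have "root_refl (vroot k a b) (vroot k i j) = vroot k i j - vroot k a b"
      using assms by (simp add: root_refl_def vroot_scalar_prod)
    then have "root_refl (vroot k a b) (vroot k i j) = eps (2 * k) (j + k) - eps (2 * k) (b + k)"
      using minus 2 by (simp add: eps0)
    then show ?thesis
      using 2 assms eps_minus_eps_pos_roots[of "j + k" "2 * k" "b + k"] by simp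
  next
    case 3
    then have "root_refl (vroot k a b) (vroot k i j) = vroot k i j - vroot k a b"
      using assms by (simp add: root_refl_def vroot_scalar_prod)
    then have "root_refl (vroot k a b) (vroot k i j) = eps (2 * k) i - eps (2 * k) a"
      using minus 3 by (simp add: eps0)
    then show ?thesis
      using 3 assms eps_minus_eps_pos_roots[of i "2 * k" a] by simp
  next
    case 4
    then have "root_refl (vroot k a b) (vroot k i j) = vroot k i j"
      using assms unfolding root_refl_def by (intro eq_vecI) (auto simp: vroot_scalar_prod)
    then show ?thesis
      using 4 assms vroot_pos_roots by simp
  qed
qed

section \<open>Orthogonal subsets of U and permutations\<close>

definition vroots :: "nat \<Rightarrow> real vec set" where
  "vroots k = {vroot k i j | i j. i \<in> {1..k} \<and> j \<in> {1..k}}"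

lemma vroot_in_vroots: "i \<in> {1..k} \<Longrightarrow> j \<in> {1..k} \<Longrightarrow> vroot k i j \<in> vroots k"
  unfolding vroots_def by blast

lemma finite_vroots: "finite (vroots k)"
proof -
  have "vroots k \<subseteq> (\<lambda>(i, j). vroot k i j) ` ({1..k} \<times> {1..k})"
    unfolding vroots_def by force
  then show ?thesis
    by (rule finite_subset) simp
qed

lemma vroots_pos_roots: "vroots k \<subseteq> pos_roots (2 * k)"
  using vroot_pos_roots by (auto simp: vroots_def)

text \<open>Projecting the index pairs to their rows is injective, which bounds the size by k; with
  k elements every row is occupied, and the column found in row i is \<pi> i.\<close>

lemma orthogonal_vroots:
  assumes "R \<subseteq> vroots k" "orthogonal_set R"
  shows "card R \<le> k" and "card R = k \<Longrightarrow> \<exists>\<pi>. \<pi> permutes {1..k} \<and> R = Rset k \<pi>"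
proof -
  define P where "P = {(i, j). i \<in> {1..k} \<and> j \<in> {1..k} \<and> vroot k i j \<in> R}"
  have R: "R = (\<lambda>(i, j). vroot k i j) ` P"
    using assms(1) by (auto simp: P_def vroots_def image_iff; blast)
  have "inj_on (\<lambda>(i, j). vroot k i j) P"
    using vroot_inject by (auto simp: inj_on_def P_def)
  then have card: "card R = card P"
    using R card_image by blast
  \<comment> \<open>Distinct members of R have product 0, so by the product formula they share
    neither a row nor a column.\<close>
  have coord: "i = a \<longleftrightarrow> j = b" if "(i, j) \<in> P" "(a, b) \<in> P" for i j a b
  proof (cases "vroot k i j = vroot k a b")
    case True
    then show ?thesis using that by (auto simp: P_def vroot_inject)
  next
    case False
    then have "vroot k i j \<bullet> vroot k a b = 0"
      using assms(2) that by (auto simp: orthogonal_set_def pairwise_def P_def)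
    then show ?thesis
      using that by (auto simp: P_def vroot_scalar_prod split: if_splits)
  qed
  have inj_fst: "inj_on fst P"
    using coord by (force simp: inj_on_def)
  have fst_P: "fst ` P \<subseteq> {1..k}"
    by (auto simp: P_def)
  have "card (fst ` P) \<le> k"
    using card_mono[OF _ fst_P] by simp
  then show "card R \<le> k"
    using card card_image[OF inj_fst] by simp
  assume "card R = k"
  then have "fst ` P = {1..k}"
    using card card_image[OF inj_fst] fst_P by (intro card_subset_eq) auto
  then have "\<forall>i\<in>{1..k}. \<exists>j. (i, j) \<in> P"
    by force
  then obtain f where f: "(i, f i) \<in> P" if "i \<in> {1..k}" for i
    by metis
  define \<pi> where "\<pi> = (\<lambda>i. if i \<in> {1..k} then f i else i)"
  have "inj_on \<pi> {1..k}"
  proof (rule inj_onI)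
    fix i j assume ij: "i \<in> {1..k}" "j \<in> {1..k}" "\<pi> i = \<pi> j"
    then show "i = j"
      using coord[OF f f, of i j] by (simp add: \<pi>_def)
  qed
  moreover have "\<pi> ` {1..k} \<subseteq> {1..k}"
    using f by (auto simp: \<pi>_def P_def)
  ultimately have "bij_betw \<pi> {1..k} {1..k}"
    by (simp add: bij_betw_def endo_inj_surj)
  then have "\<pi> permutes {1..k}"
    by (rule bij_imp_permutes) (auto simp: \<pi>_def)
  moreover have "R = Rset k \<pi>"
  proof
    show "Rset k \<pi> \<subseteq> R"
      using f by (auto simp: Rset_def \<pi>_def P_def)
    show "R \<subseteq> Rset k \<pi>"
    proof
      fix \<beta> assume "\<beta> \<in> R"
      then obtain i j where ij: "(i, j) \<in> P" "\<beta> = vroot k i j"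
        using R by auto
      then have "i \<in> {1..k}"
        by (simp add: P_def)
      moreover from this have "j = \<pi> i"
        using coord[OF ij(1) f[of i]] by (simp add: \<pi>_def)
      ultimately show "\<beta> \<in> Rset k \<pi>"
        using ij(2) by (auto simp: Rset_def)
    qed
  qed
  ultimately show "\<exists>\<pi>. \<pi> permutes {1..k} \<and> R = Rset k \<pi>"
    by blast
qed

lemma Rset_vroots:
  assumes "\<pi> permutes {1..k}"
  shows "Rset k \<pi> \<subseteq> vroots k" "orthogonal_set (Rset k \<pi>)" "card (Rset k \<pi>) = k"
    "inj_on (\<lambda>i. vroot k i (\<pi> i)) {1..k}"
proof -
  have in_iff: "\<pi> i \<in> {1..k} \<longleftrightarrow> i \<in> {1..k}" for i
    using permutes_in_image[OF assms] .
  have inj: "\<pi> i = \<pi> j \<longleftrightarrow> i = j" for i j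
    using permutes_inj[OF assms] by (simp add: inj_eq)
  show "Rset k \<pi> \<subseteq> vroots k"
    unfolding Rset_def using in_iff vroot_in_vroots by blast
  show "orthogonal_set (Rset k \<pi>)"
    unfolding orthogonal_set_def pairwise_def Rset_def
  proof (clarify)
    fix i j assume "i \<in> {1..k}" "j \<in> {1..k}" "vroot k i (\<pi> i) \<noteq> vroot k j (\<pi> j)"
    then show "vroot k i (\<pi> i) \<bullet> vroot k j (\<pi> j) = 0"
      using inj in_iff by (subst vroot_scalar_prod) auto
  qed
  show inj_on: "inj_on (\<lambda>i. vroot k i (\<pi> i)) {1..k}"
  proof (rule inj_onI)
    fix i j assume "i \<in> {1..k}" "j \<in> {1..k}" "vroot k i (\<pi> i) = vroot k j (\<pi> j)"
    then show "i = j"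
      using in_iff vroot_inject[of i k "\<pi> i" j "\<pi> j"] by blast
  qed
  then show "card (Rset k \<pi>) = k"
    by (simp add: Rset_def card_image)
qed

lemma kappa_vroots: "kappa (vroots k) = k"
  unfolding kappa_def
proof (rule Max_eqI)
  show "finite (card ` {R. R \<subseteq> vroots k \<and> orthogonal_set R})"
    by (rule finite_imageI, rule finite_subset[of _ "Pow (vroots k)"]) (auto simp: finite_vroots)
  show "m \<le> k" if "m \<in> card ` {R. R \<subseteq> vroots k \<and> orthogonal_set R}" for m
    using that orthogonal_vroots(1) by blast
  show "k \<in> card ` {R. R \<subseteq> vroots k \<and> orthogonal_set R}"
    using Rset_vroots[OF permutes_id, of k] by (intro image_eqI[of _ _ "Rset k id"]) simp_all
qed

lemma Omega_vroots: "Omega (vroots k) = Rset k ` {\<pi>. \<pi> permutes {1..k}}"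
proof
  show "Omega (vroots k) \<subseteq> Rset k ` {\<pi>. \<pi> permutes {1..k}}"
  proof
    fix R assume "R \<in> Omega (vroots k)"
    then show "R \<in> Rset k ` {\<pi>. \<pi> permutes {1..k}}"
      using orthogonal_vroots(2)[of R k] by (auto simp: Omega_def kappa_vroots)
  qed
  show "Rset k ` {\<pi>. \<pi> permutes {1..k}} \<subseteq> Omega (vroots k)"
    using Rset_vroots(1-3) by (auto simp: Omega_def kappa_vroots)
qed

lemma Rset_inject:
  assumes "\<pi> permutes {1..k}" "\<sigma> permutes {1..k}"
  shows "Rset k \<pi> = Rset k \<sigma> \<longleftrightarrow> \<pi> = \<sigma>"
proof
  assume eq: "Rset k \<pi> = Rset k \<sigma>"
  show "\<pi> = \<sigma>"
  proof
    fix i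
    show "\<pi> i = \<sigma> i"
    proof (cases "i \<in> {1..k}")
      case True
      then have "vroot k i (\<pi> i) \<in> Rset k \<sigma>"
        unfolding eq[symmetric] by (auto simp: Rset_def)
      then obtain a where a: "a \<in> {1..k}" "vroot k i (\<pi> i) = vroot k a (\<sigma> a)"
        by (auto simp: Rset_def)
      moreover have "\<pi> i \<in> {1..k}" "\<sigma> a \<in> {1..k}"
        using True a(1) permutes_in_image[OF assms(1)] permutes_in_image[OF assms(2)] by blast+
      ultimately show ?thesis
        using True vroot_inject[of i k "\<pi> i" a "\<sigma> a"] by blast
    next
      case False
      then show ?thesis
        using assms by (simp add: permutes_not_in)
    qed
  qed
qed simp

lemma Rset_inj_on: "inj_on (Rset k) {\<pi>. \<pi> permutes {1..k}}"
  using Rset_inject by (auto simp: inj_on_def)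

section \<open>Residual sets and the level\<close>

lemma vroot_in_Res_iff:
  assumes \<pi>: "\<pi> permutes {1..k}" and ij: "i \<in> {1..k}" "j \<in> {1..k}"
  shows "vroot k i j \<in> Res (2 * k) (vroots k) (Rset k \<pi>) \<longleftrightarrow> \<pi> i > j \<and> inv' \<pi> j > i"
proof -
  have "vroot k i j \<in> Res (2 * k) (vroots k) (Rset k \<pi>) \<longleftrightarrow>
      (\<forall>a\<in>{1..k}. root_refl (vroot k a (\<pi> a)) (vroot k i j) \<in> pos_roots (2 * k))"
    using ij by (auto simp: Res_def Rset_def vroots_def)
  also have "\<dots> \<longleftrightarrow> (\<forall>a\<in>{1..k}. (i = a \<longrightarrow> j < \<pi> a) \<and> (j = \<pi> a \<longrightarrow> i < a))"
    using root_refl_vroot_pos_iff[OF ij] permutes_in_image[OF \<pi>] by (intro ball_cong) auto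
  \<comment> \<open>Only two roots of \<open>Rset k \<pi>\<close> impose a condition: the one in row
    i, at a = i, and the one in column j, at a = \<open>inv' \<pi> j\<close>.\<close>
  also have "\<dots> \<longleftrightarrow> \<pi> i > j \<and> inv' \<pi> j > i"
    using ij permutes_in_image[OF permutes_inv[OF \<pi>], of j]
    by (auto simp: permutes_inverses[OF \<pi>])
  finally show ?thesis .
qed

lemma Res_vroots:
  assumes "\<pi> permutes {1..k}"
  shows "Res (2 * k) (vroots k) (Rset k \<pi>) =
    {vroot k i j | i j. i \<in> {1..k} \<and> j \<in> {1..k} \<and> \<pi> i > j \<and> inv' \<pi> j > i}"
proof -
  have "Res (2 * k) (vroots k) (Rset k \<pi>) =
      {vroot k i j | i j. i \<in> {1..k} \<and> j \<in> {1..k} \<and>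
        vroot k i j \<in> Res (2 * k) (vroots k) (Rset k \<pi>)}"
    by (auto simp: Res_def vroots_def)
  then show ?thesis
    using vroot_in_Res_iff[OF assms] by (smt (verit) Collect_cong)
qed

lemma Res_eq_rothe_diagram:
  assumes "\<pi> permutes {1..k}"
  shows "{(i, j). i \<in> {1..k} \<and> j \<in> {1..k} \<and> vroot k i j \<in> Res (2 * k) (vroots k) (Rset k \<pi>)} =
    rothe_diagram k \<pi>"
  using vroot_in_Res_iff[OF assms] by (auto simp: rothe_diagram_def)

lemma rho_Rset:
  assumes "\<pi> permutes {1..k}"
  shows "rho (2 * k) (vroots k) (Rset k \<pi>) = card (inversions \<pi>)"
proof -
  have "Res (2 * k) (vroots k) (Rset k \<pi>) = (\<lambda>(i, j). vroot k i j) ` rothe_diagram k \<pi>"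
    unfolding Res_vroots[OF assms] rothe_diagram_def by auto
  moreover have "inj_on (\<lambda>(i, j). vroot k i j) (rothe_diagram k \<pi>)"
    using vroot_inject by (auto simp: inj_on_def rothe_diagram_def)
  ultimately show ?thesis
    by (simp add: rho_def card_image card_rothe_diagram[OF assms])
qed


section \<open>Hafnians, permanents and determinants\<close>

text \<open>Specializing q acts on coefficients. Additivity suffices for this purpose because each
  summand of \<open>QHf\<close> is a single monomial with a power of q as its coefficient.\<close>

lemma poly_mapping_map_add:
  assumes "\<And>a b. f (a + b) = f a + f b" "f 0 = 0"
  shows "Poly_Mapping.map f (p + q) = Poly_Mapping.map f p + Poly_Mapping.map f q"
  by (intro poly_mapping_eqI) (auto simp: Poly_Mapping.map.rep_eq lookup_add assms(2) when_def simp flip: assms(1))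

lemma poly_mapping_map_sum:
  assumes "\<And>a b. f (a + b) = f a + f b" "f 0 = 0"
  shows "Poly_Mapping.map f (\<Sum>x\<in>A. g x) = (\<Sum>x\<in>A. Poly_Mapping.map f (g x))"
proof (induction A rule: infinite_finite_induct)
  case (insert x A)
  then show ?case by (simp add: poly_mapping_map_add[OF assms])
qed (simp_all add: Poly_Mapping.map.rep_eq poly_mapping_eqI)

lemma prod_xvar:
  "(\<Prod>i\<in>A. xvar (f i)) = Poly_Mapping.single (\<Sum>i\<in>A. Poly_Mapping.single (f i) 1) 1"
  by (induction A rule: infinite_finite_induct) (simp_all add: xvar_def mult_single)

lemma single_0_power: "Poly_Mapping.single 0 a ^ m = Poly_Mapping.single 0 (a ^ m)"
  for a :: "'b::comm_semiring_1"
  by (induction m) (simp_all add: mult_single)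

lemma qvar_power_mult_prod_xvar:
  "qvar ^ m * (\<Prod>i\<in>A. xvar (f i)) =
    Poly_Mapping.single (\<Sum>i\<in>A. Poly_Mapping.single (f i) 1) ([:0, 1:] ^ m)"
  by (simp add: qvar_def single_0_power prod_xvar mult_single)

lemma minus_qvar_power_mult_prod_xvar:
  "(- qvar) ^ m * (\<Prod>i\<in>A. xvar (f i)) =
    Poly_Mapping.single (\<Sum>i\<in>A. Poly_Mapping.single (f i) 1) ([:0, - 1:] ^ m)"
proof -
  have "- qvar = Poly_Mapping.single 0 [:0, - 1:]"
    by (simp add: qvar_def single_uminus[symmetric])
  then show ?thesis
    by (simp add: single_0_power prod_xvar mult_single)
qed

lemma QHf_vroots:
  "QHf (2 * k) (vroots k) =
    (\<Sum>\<pi> | \<pi> permutes {1..k}. qvar ^ card (inversions \<pi>) * (\<Prod>i = 1..k. xvar (vroot k i (\<pi> i))))"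
  unfolding QHf_def Omega_vroots sum.reindex[OF Rset_inj_on] o_def
proof (rule sum.cong[OF refl], clarify)
  fix \<pi> assume \<pi>: "\<pi> permutes {1..k}"
  have "(\<Prod>\<beta>\<in>Rset k \<pi>. xvar \<beta>) = (\<Prod>i = 1..k. xvar (vroot k i (\<pi> i)) :: int poly root_poly)"
    unfolding Rset_def prod.reindex[OF Rset_vroots(4)[OF \<pi>]] o_def ..
  then show "qvar ^ rho (2 * k) (vroots k) (Rset k \<pi>) * (\<Prod>\<beta>\<in>Rset k \<pi>. xvar \<beta>) =
      qvar ^ card (inversions \<pi>) * (\<Prod>i = 1..k. xvar (vroot k i (\<pi> i)))"
    by (simp add: rho_Rset[OF \<pi>])
qed

text \<open>Common source of the three specializations: f is p(-q) for \<open>QPf\<close>, p(1) for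
  \<open>Hf\<close> and p(-1) for \<open>Pf\<close>.\<close>

lemma map_QHf_vroots:
  assumes "\<And>a b. f (a + b) = f a + f b" "f 0 = 0"
  shows "Poly_Mapping.map f (QHf (2 * k) (vroots k)) =
    (\<Sum>\<pi> | \<pi> permutes {1..k}. Poly_Mapping.single
      (\<Sum>i = 1..k. Poly_Mapping.single (vroot k i (\<pi> i)) 1) (f ([:0, 1:] ^ card (inversions \<pi>))))"
  unfolding QHf_vroots poly_mapping_map_sum[of f, OF assms] qvar_power_mult_prod_xvar
  by (simp add: assms)

lemma QPf_vroots:
  "QPf (2 * k) (vroots k) =
    (\<Sum>\<pi> | \<pi> permutes {1..k}. (- qvar) ^ card (inversions \<pi>) *
      (\<Prod>i = 1..k. xvar (vroot k i (\<pi> i))))"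
proof -
  have "pcompose ([:0, 1:] ^ m) [:0, - 1:] = [:0, - 1 :: int:] ^ m" for m
    by (induction m) (simp_all add: pcompose_1 pcompose_mult pcompose_pCons)
  then show ?thesis
    unfolding QPf_def minus_qvar_power_mult_prod_xvar
    by (subst map_QHf_vroots) (simp_all add: pcompose_add)
qed

lemma Hf_vroots:
  "Hf (2 * k) (vroots k) = (\<Sum>\<pi> | \<pi> permutes {1..k}. \<Prod>i = 1..k. xvar (vroot k i (\<pi> i)))"
  unfolding Hf_def prod_xvar by (subst map_QHf_vroots) (simp_all add: poly_power)

text \<open>At q = -1 the coefficient becomes -1 to the number of inversions, which is the sign;
  this yields the Leibniz expansion.\<close>

lemma Pf_vroots:
  "Pf (2 * k) (vroots k) =
    (\<Sum>\<pi> | \<pi> permutes {1..k}. of_int (sign \<pi>) * (\<Prod>i = 1..k. xvar (vroot k i (\<pi> i))))"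
proof -
  have of_int_single: "of_int z * Poly_Mapping.single a 1 = Poly_Mapping.single a z"
    for z :: int and a :: "real vec \<Rightarrow>\<^sub>0 nat"
  proof -
    have "(of_int z :: int root_poly) = Poly_Mapping.single 0 z"
      by (simp del: single_of_int add: single_of_int[symmetric])
    then show ?thesis
      by (simp add: mult_single)
  qed
  show ?thesis
    unfolding Pf_def prod_xvar of_int_single
    by (subst map_QHf_vroots)
      (auto simp: poly_power sign_eq_inversions[of _ 1 "Suc k"] atLeastLessThanSuc_atLeastAtMost
        intro!: sum.cong)
qed

lemma permanent_vmat:
  "permanent (vmat k) = (\<Sum>\<pi> | \<pi> permutes {1..k}. \<Prod>i = 1..k. xvar (vroot k i (\<pi> i)))"
proof -
  have "permanent (vmat k) =
      (\<Sum>p | p permutes {0..<k}. \<Prod>i = 0..<k. xvar (vroot k (Suc i) (Suc (p i))) :: 'a root_poly)"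
    unfolding permanent_def vmat_def
    by (auto intro!: sum.cong prod.cong dest: permutes_in_image)
  also have "\<dots> = (\<Sum>\<pi> | \<pi> permutes {1..k}. \<Prod>i = 1..k. xvar (vroot k i (\<pi> i)))"
    by (rule sum_permutes_shift[of "\<lambda>_ x. x"])
  finally show ?thesis .
qed

lemma det_vmat:
  "det (vmat k) =
    (\<Sum>\<pi> | \<pi> permutes {1..k}. of_int (sign \<pi>) * (\<Prod>i = 1..k. xvar (vroot k i (\<pi> i))))"
proof -
  have "det (vmat k) = (\<Sum>p | p permutes {0..<k}. of_int (sign p) *
      (\<Prod>i = 0..<k. xvar (vroot k (Suc i) (Suc (p i))) :: 'a root_poly))"
    unfolding det_def vmat_def
    by (auto intro!: sum.cong prod.cong arg_cong2[where f = "(*)"] dest: permutes_in_image)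
  also have "\<dots> = (\<Sum>\<pi> | \<pi> permutes {1..k}. of_int (sign \<pi>) *
      (\<Prod>i = 1..k. xvar (vroot k i (\<pi> i))))"
    by (rule sum_permutes_shift[of "\<lambda>s x. of_int s * x"])
  finally show ?thesis .
qed

lemma q_permanent_vmat:
  "q_permanent q (vmat k) =
    (\<Sum>\<pi> | \<pi> permutes {1..k}. q ^ card (inversions \<pi>) * (\<Prod>i = 1..k. xvar (vroot k i (\<pi> i))))"
proof -
  have "vmat k $$ (i - 1, \<pi> i - 1) = (xvar (vroot k i (\<pi> i)) :: 'a root_poly)"
    if "\<pi> permutes {1..k}" "i \<in> {1..k}" for \<pi> i
    using that permutes_in_image[OF that(1), of i] by (auto simp: vmat_def)
  then show ?thesis
    unfolding q_permanent_def
    by (auto simp: vmat_def perm_length_eq_inversions intro!: sum.cong)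
qed

lemma quantum_row_permanent_eq: "quantum_row_permanent q A = q_permanent (- q) A"
  by (simp add: quantum_row_permanent_def q_permanent_def)

lemma PS_vroots: "PS (2 * k) (vroots k) = (\<Prod>i = 2..k. q_int i)"
  unfolding PS_def Omega_vroots sum.reindex[OF Rset_inj_on] o_def sum_inversions[symmetric]
  by (rule sum.cong) (simp_all add: rho_Rset)

lemma is_degrees_vroots: "is_degrees (2 * k) (vroots k) (mset [2..<k + 1])"
proof -
  have "(\<Prod>d\<in>#mset [2..<k + 1]. q_int d) = (\<Prod>i = 2..k. q_int i)"
    by (simp only: mset_upt prod_unfold_prod_mset Suc_eq_plus1[symmetric]
        atLeastLessThanSuc_atLeastAtMost)
  then show ?thesis
    unfolding is_degrees_def PS_vroots by auto
qed


section \<open>The action of the parabolic subgroup\<close>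

text \<open>The inverse makes \<open>eps n i\<close> go to \<open>eps n (p i)\<close>, so that
  composition is preserved and not reversed. \<open>Suc\<close> and \<open>- 1\<close> translate
  between coordinates counted from 0 and permutations of {1..n}.\<close>

definition coord_perm :: "nat \<Rightarrow> (nat \<Rightarrow> nat) \<Rightarrow> real vec \<Rightarrow> real vec" where
  "coord_perm n p = (\<lambda>v\<in>carrier_vec n. vec n (\<lambda>m. v $ (inv' p (Suc m) - 1)))"

lemma coord_perm_carrier [simp]: "v \<in> carrier_vec n \<Longrightarrow> coord_perm n p v \<in> carrier_vec n"
  by (simp add: coord_perm_def)

text \<open>Ensures that the subtraction in \<open>coord_perm\<close> neither truncates nor leaves
  the index range.\<close>

lemma inv_index_less:
  assumes "p permutes {1..n}" "m < n"
  shows "inv' p (Suc m) - Suc 0 < n" "Suc (inv' p (Suc m) - Suc 0) = inv' p (Suc m)"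
  using permutes_in_image[OF permutes_inv[OF assms(1)], of "Suc m"] assms(2) by auto

lemma coord_perm_compose:
  assumes p: "p permutes {1..n}" and q: "q permutes {1..n}"
  shows "coord_perm n (p \<circ> q) = compose (carrier_vec n) (coord_perm n p) (coord_perm n q)"
proof
  fix v
  show "coord_perm n (p \<circ> q) v = compose (carrier_vec n) (coord_perm n p) (coord_perm n q) v"
  proof (cases "v \<in> carrier_vec n")
    case True
    have "inv' (p \<circ> q) = inv' q \<circ> inv' p"
      by (rule o_inv_distrib[OF permutes_bij[OF p] permutes_bij[OF q]])
    with True show ?thesis
      by (intro eq_vecI)
        (simp_all add: coord_perm_def compose_def inv_index_less[OF p])
  next
    case False
    then show ?thesis by (simp add: coord_perm_def compose_def)
  qed
qed

lemma coord_perm_id: "coord_perm n id = (\<lambda>v\<in>carrier_vec n. v)"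
  unfolding coord_perm_def by (intro restrict_ext eq_vecI) auto

lemma coord_perm_Bij:
  assumes p: "p permutes {1..n}"
  shows "coord_perm n p \<in> Bij (carrier_vec n)"
proof -
  have "coord_perm n q (coord_perm n r v) = v"
    if "q permutes {1..n}" "r permutes {1..n}" "q \<circ> r = id" "v \<in> carrier_vec n" for q r v
    using coord_perm_compose[OF that(1,2)] that(3,4) coord_perm_id
    by (metis compose_eq restrict_apply')
  then have "bij_betw (coord_perm n p) (carrier_vec n) (carrier_vec n)"
    using p permutes_inv[OF p] permutes_inv_o[OF p]
    by (intro bij_betw_byWitness[where f' = "coord_perm n (inv' p)"]) auto
  then show ?thesis
    by (simp add: Bij_def coord_perm_def)
qed

lemma coord_perm_eps:
  assumes "p permutes {1..n}" "i \<in> {1..n}"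
  shows "coord_perm n p (eps n i) = eps n (p i)"
proof (intro eq_vecI)
  fix m assume "m < dim_vec (eps n (p i))"
  then have m: "m < n" by (simp add: eps_def)
  have "inv' p (Suc m) = i \<longleftrightarrow> p i = Suc m"
    using permutes_inv_eq[OF assms(1)] by auto
  moreover have "inv' p (Suc m) - 1 = i - 1 \<longleftrightarrow> inv' p (Suc m) = i"
    using inv_index_less[OF assms(1) m] assms(2) by auto
  moreover have "m = p i - 1 \<longleftrightarrow> p i = Suc m"
    using permutes_in_image[OF assms(1), of i] assms(2) by auto
  moreover have "p i - 1 < n" "i - 1 < n"
    using permutes_in_image[OF assms(1), of i] assms(2) by auto
  ultimately show "coord_perm n p (eps n i) $ m = eps n (p i) $ m"
    using m inv_index_less[OF assms(1) m] by (simp add: coord_perm_def eps_def)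
qed (simp add: coord_perm_def eps_def)

lemma coord_perm_add:
  assumes "p permutes {1..n}" "v \<in> carrier_vec n" "w \<in> carrier_vec n"
  shows "coord_perm n p (v + w) = coord_perm n p v + coord_perm n p w"
  using assms(2,3) inv_index_less(1)[OF assms(1)]
  by (intro eq_vecI) (auto simp: coord_perm_def)

lemma eps_inject: "i \<in> {1..n} \<Longrightarrow> j \<in> {1..n} \<Longrightarrow> eps n i = eps n j \<longleftrightarrow> i = j"
  using eps_scalar_prod[of i n i] eps_scalar_prod[of i n j] by (auto split: if_splits)

lemma coord_perm_inject:
  assumes "p permutes {1..n}" "q permutes {1..n}" "coord_perm n p = coord_perm n q"
  shows "p = q"
proof
  fix i
  show "p i = q i"
  proof (cases "i \<in> {1..n}")
    case True
    then have "eps n (p i) = eps n (q i)"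
      using coord_perm_eps[OF assms(1)] coord_perm_eps[OF assms(2)] assms(3) by metis
    then show ?thesis
      using True eps_inject permutes_in_image[OF assms(1)] permutes_in_image[OF assms(2)] by metis
  qed (use assms in \<open>simp add: permutes_not_in\<close>)
qed

text \<open>Subtracting the difference of two coordinates from one of them and adding it to the
  other exchanges them.\<close>

lemma simple_refl_eq_coord_perm:
  assumes "1 \<le> i" "i < n"
  shows "simple_refl n i = coord_perm n (transpose i (Suc i))"
  unfolding simple_refl_def coord_perm_def
proof (intro restrict_ext eq_vecI)
  fix v :: "real vec" and m
  assume v: "v \<in> carrier_vec n"
  assume "m < dim_vec (vec n (\<lambda>m. v $ (inv' (transpose i (Suc i)) (Suc m) - 1)))"
  then have m: "m < n" by simp
  have "simple_root n i \<bullet> v = v $ (i - 1) - v $ i"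
    using assms v by (simp add: simple_root_def eps_def minus_scalar_prod_distrib[of _ n])
  then show "root_refl (simple_root n i) v $ m =
      vec n (\<lambda>m. v $ (inv' (transpose i (Suc i)) (Suc m) - 1)) $ m"
    using assms v m
    by (auto simp: root_refl_def simple_root_def eps_def transpose_def)
qed (use assms in \<open>auto simp: root_refl_def simple_root_def eps_def\<close>)

section \<open>Permutations of the two blocks of coordinates\<close>

definition juxtapose :: "nat \<Rightarrow> (nat \<Rightarrow> nat) \<Rightarrow> (nat \<Rightarrow> nat) \<Rightarrow> nat \<Rightarrow> nat" where
  "juxtapose k \<sigma> \<tau> i = (if i \<le> k then \<sigma> i else k + \<tau> (i - k))"

text \<open>The blocks do not mix: \<sigma>' preserves {0..k}, and \<tau>' keeps positive numbers
  positive, so the outer map takes the same branch as the inner one.\<close>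

lemma juxtapose_comp:
  assumes \<sigma>': "\<sigma>' permutes {1..k}" and \<tau>': "\<tau>' permutes {1..k}"
  shows "juxtapose k (\<sigma> \<circ> \<sigma>') (\<tau> \<circ> \<tau>') = juxtapose k \<sigma> \<tau> \<circ> juxtapose k \<sigma>' \<tau>'"
proof
  fix i
  have "\<sigma>' i \<le> k" if "i \<le> k"
    using that permutes_in_image[OF \<sigma>', of i] permutes_not_in[OF \<sigma>', of i]
    by (cases "i = 0") auto
  moreover have "0 < \<tau>' (i - k)" if "k < i"
    using that permutes_in_image[OF \<tau>', of "i - k"] permutes_not_in[OF \<tau>', of "i - k"]
    by (cases "i - k \<le> k") auto
  ultimately show "juxtapose k (\<sigma> \<circ> \<sigma>') (\<tau> \<circ> \<tau>') i = (juxtapose k \<sigma> \<tau> \<circ> juxtapose k \<sigma>' \<tau>') i"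
    by (auto simp: juxtapose_def)
qed

lemma juxtapose_id: "juxtapose k id id = id"
  by (auto simp: juxtapose_def)

lemma juxtapose_permutes:
  assumes \<sigma>: "\<sigma> permutes {1..k}" and \<tau>: "\<tau> permutes {1..k}"
  shows "juxtapose k \<sigma> \<tau> permutes {1..2 * k}"
proof -
  let ?p = "juxtapose k \<sigma> \<tau>" and ?q = "juxtapose k (inv' \<sigma>) (inv' \<tau>)"
  have "?p \<circ> ?q = id" "?q \<circ> ?p = id"
    using juxtapose_comp[OF permutes_inv[OF \<sigma>] permutes_inv[OF \<tau>], of \<sigma> \<tau>]
      juxtapose_comp[OF \<sigma> \<tau>, of "inv' \<sigma>" "inv' \<tau>"]
    by (simp_all add: permutes_inv_o[OF \<sigma>] permutes_inv_o[OF \<tau>] juxtapose_id)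
  then have "bij ?p"
    using o_bij by blast
  moreover have "?p i = i" if "i \<notin> {1..2 * k}" for i
  proof (cases "i = 0")
    case True
    then show ?thesis
      using permutes_not_in[OF \<sigma>, of i] by (simp add: juxtapose_def)
  next
    case False
    then have "2 * k < i" using that by simp
    moreover from this have "\<tau> (i - k) = i - k"
      by (intro permutes_not_in[OF \<tau>]) auto
    ultimately show ?thesis
      by (simp add: juxtapose_def)
  qed
  ultimately show ?thesis
    unfolding permutes_def bij_iff by blast
qed

lemma juxtapose_inject:
  assumes "\<sigma> permutes {1..k}" "\<tau> permutes {1..k}" "\<sigma>' permutes {1..k}" "\<tau>' permutes {1..k}"
    and eq: "juxtapose k \<sigma> \<tau> = juxtapose k \<sigma>' \<tau>'"
  shows "\<sigma> = \<sigma>' \<and> \<tau> = \<tau>'"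
proof -
  have "\<sigma> i = \<sigma>' i" "\<tau> i = \<tau>' i" for i
  proof -
    show "\<sigma> i = \<sigma>' i"
      using fun_cong[OF eq, of i] assms(1,3)
      by (cases "i \<in> {1..k}") (auto simp: juxtapose_def permutes_not_in)
    show "\<tau> i = \<tau>' i"
      using fun_cong[OF eq, of "k + i"] assms(2,4)
      by (cases "i \<in> {1..k}") (auto simp: juxtapose_def permutes_not_in)
  qed
  then show ?thesis by auto
qed

lemma juxtapose_transpose_left:
  "1 \<le> i \<Longrightarrow> i < k \<Longrightarrow> juxtapose k (transpose i (Suc i)) id = transpose i (Suc i)"
  by (auto simp: juxtapose_def transpose_def)

lemma juxtapose_transpose_right:
  "1 \<le> i \<Longrightarrow> juxtapose k id (transpose i (Suc i)) = transpose (k + i) (Suc (k + i))"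
  by (rule ext) (auto simp: juxtapose_def transpose_def)

definition block_perm :: "nat \<Rightarrow> (nat \<Rightarrow> nat) \<times> (nat \<Rightarrow> nat) \<Rightarrow> real vec \<Rightarrow> real vec" where
  "block_perm k = (\<lambda>(\<sigma>, \<tau>). coord_perm (2 * k) (juxtapose k \<sigma> \<tau>))"

text \<open>I given by its indices. As I is defined by removing maps and not indices, the agreement
  has to be proved in \<open>levi_refls_eq_Diff\<close>.\<close>

definition levi_refls :: "nat \<Rightarrow> (real vec \<Rightarrow> real vec) set" where
  "levi_refls k = simple_refl (2 * k) ` ({1..<k} \<union> {k + 1..<2 * k})"

abbreviation (input) sym_prod :: "nat \<Rightarrow> ((nat \<Rightarrow> nat) \<times> (nat \<Rightarrow> nat)) monoid" where
  "sym_prod k \<equiv> sym_group k \<times>\<times> sym_group k"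

lemma group_sym_prod: "group (sym_prod k)"
  by (intro DirProd_group sym_group_is_group)

lemma carrier_sym_prod: "(\<sigma>, \<tau>) \<in> carrier (sym_prod k) \<longleftrightarrow> \<sigma> permutes {1..k} \<and> \<tau> permutes {1..k}"
  by (simp add: sym_group_carrier)

lemma levi_refls_eq:
  "levi_refls k = (\<lambda>i. block_perm k (transpose i (Suc i), id)) ` {1..<k} \<union>
    (\<lambda>i. block_perm k (id, transpose i (Suc i))) ` {1..<k}"
proof -
  have "simple_refl (2 * k) i = block_perm k (transpose i (Suc i), id)" if "i \<in> {1..<k}" for i
    using that by (simp add: block_perm_def simple_refl_eq_coord_perm juxtapose_transpose_left)
  moreover have "simple_refl (2 * k) (k + i) = block_perm k (id, transpose i (Suc i))"
    if "i \<in> {1..<k}" for i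
    using that by (simp add: block_perm_def simple_refl_eq_coord_perm juxtapose_transpose_right)
  moreover have "{k + 1..<2 * k} = (+) k ` {1..<k}"
    by (simp add: mult_2)
  ultimately show ?thesis
    unfolding levi_refls_def image_Un by (simp only: image_image cong: image_cong)
qed

lemma levi_refls_cases:
  assumes "s \<in> levi_refls k"
  obtains i where "1 \<le> i" "i < k" "s = block_perm k (transpose i (Suc i), id)"
  | i where "1 \<le> i" "i < k" "s = block_perm k (id, transpose i (Suc i))"
  using assms unfolding levi_refls_eq by auto

text \<open>The removed maps must differ from all remaining generators:
  \<open>simple_refl ?n k\<close> because distinct permutations move coordinates differently,
  \<open>simple_refl ?n ?n\<close> because it produces a negative entry.\<close>

lemma levi_refls_eq_Diff:
  assumes "2 \<le> k"
  shows "simple_refls (2 * k) - {simple_refl (2 * k) k, simple_refl (2 * k) (2 * k)} = levi_refls k"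
proof -
  let ?n = "2 * k"
  have swap: "transpose i (Suc i) permutes {1..?n}" if "1 \<le> i" "i < ?n" for i
    using that by (intro permutes_swap_id) auto
  have "simple_refl ?n i \<noteq> simple_refl ?n k" if "1 \<le> i" "i < ?n" "i \<noteq> k" for i
  proof
    assume "simple_refl ?n i = simple_refl ?n k"
    then have "transpose i (Suc i) = transpose k (Suc k)"
      using that assms coord_perm_inject[OF swap swap, of i k]
      by (simp add: simple_refl_eq_coord_perm)
    then have "transpose i (Suc i) i = transpose k (Suc k) i" by simp
    then show False
      using that by (auto simp: transpose_def split: if_splits)
  qed
  moreover have "simple_refl ?n i \<noteq> simple_refl ?n ?n" if "1 \<le> i" "i < ?n" for i
  proof
    assume eq: "simple_refl ?n i = simple_refl ?n ?n"
    \<comment> \<open>The last simple reflection sends the last basis vector to minus its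
      predecessor, whose nonzero coordinate has index ?n - 2 counted from 0. A coordinate
      permutation sends basis vectors to basis vectors.\<close>
    have "eps ?n j $ (?n - Suc (Suc 0)) \<ge> 0" for j
      using assms by (simp add: eps_def unit_vec_def)
    then have "simple_refl ?n i (eps ?n ?n) $ (?n - Suc (Suc 0)) \<ge> 0"
      using assms that coord_perm_eps[OF swap[OF that], of ?n]
      by (simp add: simple_refl_eq_coord_perm)
    moreover have "simple_refl ?n ?n (eps ?n ?n) $ (?n - Suc (Suc 0)) = - 1"
      using assms
      by (simp add: simple_refl_def root_refl_def simple_root_def eps_def
          add_scalar_prod_distrib[of _ ?n])
    ultimately show False
      using eq by simp
  qed
  moreover have "simple_refls ?n = simple_refl ?n ` ({1..<k} \<union> {k + 1..<?n} \<union> {k, ?n})"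
    unfolding simple_refls_def using assms by (intro arg_cong[where f = "image _"]) auto
  ultimately show ?thesis
    unfolding levi_refls_def by force
qed

lemma block_perm_mult:
  assumes "x \<in> carrier (sym_prod k)" "y \<in> carrier (sym_prod k)"
  shows "block_perm k (x \<otimes>\<^bsub>sym_prod k\<^esub> y) =
    compose (carrier_vec (2 * k)) (block_perm k x) (block_perm k y)"
proof -
  obtain \<sigma> \<tau> \<sigma>' \<tau>' where xy: "x = (\<sigma>, \<tau>)" "y = (\<sigma>', \<tau>')"
    by (cases x; cases y)
  then have p: "\<sigma> permutes {1..k}" "\<tau> permutes {1..k}" "\<sigma>' permutes {1..k}" "\<tau>' permutes {1..k}"
    using assms by (simp_all only: carrier_sym_prod)
  show ?thesis
    using coord_perm_compose[OF juxtapose_permutes[OF p(1,2)] juxtapose_permutes[OF p(3,4)]]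
    by (simp add: xy block_perm_def sym_group_mult juxtapose_comp[OF p(3,4)])
qed

lemma block_perm_Bij:
  assumes "x \<in> carrier (sym_prod k)"
  shows "block_perm k x \<in> Bij (carrier_vec (2 * k))"
proof -
  obtain \<sigma> \<tau> where x: "x = (\<sigma>, \<tau>)"
    by (cases x)
  then have "\<sigma> permutes {1..k}" "\<tau> permutes {1..k}"
    using assms by (simp_all only: carrier_sym_prod)
  from coord_perm_Bij[OF juxtapose_permutes[OF this]] show ?thesis
    by (simp add: x block_perm_def)
qed

lemma block_perm_hom: "block_perm k \<in> hom (sym_prod k) (BijGroup (carrier_vec (2 * k)))"
  by (rule homI) (simp_all only: block_perm_Bij block_perm_mult BijGroup_def
      partial_object.simps monoid.simps restrict_apply')

lemma block_perm_comp:
  assumes "\<sigma> permutes {1..k}" "\<tau> permutes {1..k}" "\<sigma>' permutes {1..k}" "\<tau>' permutes {1..k}"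
  shows "block_perm k (\<sigma> \<circ> \<sigma>', \<tau> \<circ> \<tau>') =
    block_perm k (\<sigma>, \<tau>) \<otimes>\<^bsub>BijGroup (carrier_vec (2 * k))\<^esub> block_perm k (\<sigma>', \<tau>')"
proof -
  have "(\<sigma>, \<tau>) \<in> carrier (sym_prod k)" "(\<sigma>', \<tau>') \<in> carrier (sym_prod k)"
    using assms by (simp_all only: carrier_sym_prod simp_thms)
  from hom_mult[OF block_perm_hom this] show ?thesis
    by (simp add: sym_group_mult)
qed

lemma block_perm_inj_on: "inj_on (block_perm k) (carrier (sym_prod k))"
proof (rule inj_onI)
  fix x y assume "x \<in> carrier (sym_prod k)" "y \<in> carrier (sym_prod k)"
    "block_perm k x = block_perm k y"
  moreover obtain \<sigma> \<tau> \<sigma>' \<tau>' where "x = (\<sigma>, \<tau>)" "y = (\<sigma>', \<tau>')"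
    by (cases x; cases y)
  ultimately show "x = y"
    unfolding block_perm_def
    by (metis carrier_sym_prod case_prod_conv coord_perm_inject juxtapose_inject
        juxtapose_permutes)
qed

lemma block_perm_vroot:
  assumes \<sigma>: "\<sigma> permutes {1..k}" and \<tau>: "\<tau> permutes {1..k}" and "i \<in> {1..k}" "j \<in> {1..k}"
  shows "block_perm k (\<sigma>, \<tau>) (vroot k i j) = vroot k (\<sigma> i) (\<tau> j)"
proof -
  have "juxtapose k \<sigma> \<tau> i = \<sigma> i" "juxtapose k \<sigma> \<tau> (j + k) = \<tau> j + k"
    using assms by (auto simp: juxtapose_def)
  moreover have "i \<in> {1..2 * k}" "j + k \<in> {1..2 * k}"
    using assms by auto
  ultimately show ?thesis
    using juxtapose_permutes[OF \<sigma> \<tau>]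
    by (simp only: block_perm_def vroot_def prod.case coord_perm_add coord_perm_eps eps_carrier)
qed

section \<open>The isomorphism of W_I with S_k x S_k\<close>

abbreviation levi :: "nat \<Rightarrow> (real vec \<Rightarrow> real vec) monoid" where
  "levi k \<equiv> parabolic_D (2 * k) (levi_refls k)"

lemma levi_refls_subset_carrier: "levi_refls k \<subseteq> block_perm k ` carrier (sym_prod k)"
proof
  fix s assume "s \<in> levi_refls k"
  then show "s \<in> block_perm k ` carrier (sym_prod k)"
  proof (cases rule: levi_refls_cases)
    case (1 i)
    then have "transpose i (Suc i) permutes {1..k}"
      by (intro permutes_swap_id) auto
    with 1 show ?thesis
      using carrier_sym_prod permutes_id by blast
  next
    case (2 i)
    then have "transpose i (Suc i) permutes {1..k}"
      by (intro permutes_swap_id) auto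
    with 2 show ?thesis
      using carrier_sym_prod permutes_id by blast
  qed
qed

text \<open>The image of \<open>block_perm\<close> is a subgroup containing the generators, which
  gives one inclusion. For the other, a pair (\<sigma>, \<tau>) is split as (\<sigma>, id) times
  (id, \<tau>), and each factor is built from adjacent transpositions of its block.\<close>

lemma
  shows mult_levi: "mult (levi k) = mult (BijGroup (carrier_vec (2 * k)))"
    and group_levi: "group (levi k)"
    and carrier_levi: "carrier (levi k) = block_perm k ` carrier (sym_prod k)"
proof -
  let ?B = "BijGroup (carrier_vec (2 * k)) :: (real vec \<Rightarrow> real vec) monoid"
  let ?L = "levi_refls k"
  interpret B: group ?B
    by (rule group_BijGroup)
  interpret h: group_hom "sym_prod k" ?B "block_perm k"
    using group_sym_prod block_perm_hom by (intro group_hom.intro group_hom_axioms.intro) auto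
  show "mult (levi k) = mult ?B"
    by (simp add: parabolic_D_def weyl_D_def)
  have weyl: "group (weyl_D (2 * k))"
    by (simp add: weyl_D_def)
  then show "group (levi k)"
    unfolding parabolic_D_def by (rule group.group_subgroup_generated)
  \<comment> \<open>\<open>subgroup_generated\<close> intersects its generators with the carrier, so
    membership is checked at both levels: in the bijection group and in the Weyl group.\<close>
  have L: "?L \<subseteq> carrier ?B"
    using levi_refls_subset_carrier h.hom_closed by blast
  have "?L \<subseteq> simple_refls (2 * k)"
    by (auto simp: levi_refls_def simple_refls_def)
  then have L_weyl: "?L \<subseteq> carrier (weyl_D (2 * k))"
    unfolding weyl_D_def carrier_subgroup_generated using L by (blast intro: generate.incl)
  have "carrier (levi k) = generate (weyl_D (2 * k)) ?L"
    using L_weyl by (simp add: parabolic_D_def carrier_subgroup_generated Int_absorb1)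
  \<comment> \<open>Generating in the Weyl group or in all bijections gives the same set; the image
    of \<open>block_perm\<close> is known as a subgroup of the latter.\<close>
  also have "\<dots> = generate ?B ?L"
  proof -
    have "weyl_D (2 * k) = ?B\<lparr>carrier := carrier (weyl_D (2 * k))\<rparr>"
      by (simp add: weyl_D_def subgroup_generated_def)
    moreover have "subgroup (carrier (weyl_D (2 * k))) ?B"
      unfolding weyl_D_def by (rule B.subgroup_subgroup_generated)
    ultimately show ?thesis
      using B.generate_consistent[OF L_weyl] by simp
  qed
  also have "\<dots> = block_perm k ` carrier (sym_prod k)"
  proof
    show "generate ?B ?L \<subseteq> block_perm k ` carrier (sym_prod k)"
      using levi_refls_subset_carrier h.img_is_subgroup by (rule B.generate_subgroup_incl)
    have left: "block_perm k (\<sigma>, id) \<in> generate ?B ?L" if "\<sigma> permutes {1..<Suc k}" for \<sigma>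
      using that
    proof (induction rule: permutes_adjacent_induct)
      case id
      have "block_perm k (id, id) = \<one>\<^bsub>?B\<^esub>"
        by (simp add: block_perm_def juxtapose_id coord_perm_id BijGroup_def)
      then have "block_perm k (id, id) \<in> generate ?B ?L"
        by (simp add: generate.one)
      then show ?case .
    next
      case (step \<sigma> i)
      let ?s = "transpose i (Suc i)"
      have "?s permutes {1..k}"
        using step.hyps by (intro permutes_swap_id) auto
      then have "block_perm k (\<sigma> \<circ> ?s, id) = block_perm k (\<sigma>, id) \<otimes>\<^bsub>?B\<^esub> block_perm k (?s, id)"
        using block_perm_comp[of \<sigma> k id ?s id] step.hyps(1) permutes_id
        by (simp add: atLeastLessThanSuc_atLeastAtMost)
      moreover have "block_perm k (?s, id) \<in> ?L"
        unfolding levi_refls_eq using step.hyps by auto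
      ultimately have "block_perm k (\<sigma> \<circ> ?s, id) \<in> generate ?B ?L"
        by (metis step.IH generate.eng generate.incl)
      then show ?case .
    qed
    have right: "block_perm k (id, \<tau>) \<in> generate ?B ?L" if "\<tau> permutes {1..<Suc k}" for \<tau>
      using that
    proof (induction rule: permutes_adjacent_induct)
      case id
      have "block_perm k (id, id) \<in> generate ?B ?L"
        by (rule left) (simp add: permutes_id)
      then show ?case .
    next
      case (step \<tau> i)
      let ?s = "transpose i (Suc i)"
      have "?s permutes {1..k}"
        using step.hyps by (intro permutes_swap_id) auto
      then have "block_perm k (id, \<tau> \<circ> ?s) = block_perm k (id, \<tau>) \<otimes>\<^bsub>?B\<^esub> block_perm k (id, ?s)"
        using block_perm_comp[of id k \<tau> id ?s] step.hyps(1) permutes_id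
        by (simp add: atLeastLessThanSuc_atLeastAtMost)
      moreover have "block_perm k (id, ?s) \<in> ?L"
        unfolding levi_refls_eq using step.hyps by auto
      ultimately have "block_perm k (id, \<tau> \<circ> ?s) \<in> generate ?B ?L"
        by (metis step.IH generate.eng generate.incl)
      then show ?case .
    qed
    show "block_perm k ` carrier (sym_prod k) \<subseteq> generate ?B ?L"
    proof
      fix w assume "w \<in> block_perm k ` carrier (sym_prod k)"
      then obtain \<sigma> \<tau> where w: "w = block_perm k (\<sigma>, \<tau>)"
        and \<sigma>: "\<sigma> permutes {1..k}" and \<tau>: "\<tau> permutes {1..k}"
        by (force simp: sym_group_carrier)
      have "w = block_perm k (\<sigma>, id) \<otimes>\<^bsub>?B\<^esub> block_perm k (id, \<tau>)"
        using block_perm_comp[OF \<sigma> permutes_id permutes_id \<tau>] by (simp add: w)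
      then show "w \<in> generate ?B ?L"
        using left right \<sigma> \<tau> by (simp add: generate.eng atLeastLessThanSuc_atLeastAtMost)
    qed
  qed
  finally show "carrier (levi k) = block_perm k ` carrier (sym_prod k)" .
qed

lemma block_perm_iso: "block_perm k \<in> iso (sym_prod k) (levi k)"
  using block_perm_hom[of k] block_perm_inj_on[of k]
  by (auto simp: iso_def hom_def bij_betw_def carrier_levi mult_levi)

lemma levi_iso: "levi k \<cong> sym_prod k"
  using group.iso_sym[OF group_sym_prod] block_perm_iso is_isoI by blast

section \<open>The action of W_I on permutations\<close>

lemma std_act_Rset:
  assumes \<sigma>: "\<sigma> permutes {1..k}" and \<tau>: "\<tau> permutes {1..k}" and \<pi>: "\<pi> permutes {1..k}"
  shows "std_act (2 * k) (block_perm k (\<sigma>, \<tau>)) (Rset k \<pi>) = Rset k (\<tau> \<circ> \<pi> \<circ> inv' \<sigma>)"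
proof -
  have "std_act (2 * k) (block_perm k (\<sigma>, \<tau>)) (Rset k \<pi>) =
      (\<lambda>i. abs_root (2 * k) (block_perm k (\<sigma>, \<tau>) (vroot k i (\<pi> i)))) ` {1..k}"
    by (simp add: std_act_def Rset_def image_image)
  also have "\<dots> = (\<lambda>i. vroot k (\<sigma> i) (\<tau> (\<pi> i))) ` {1..k}"
  proof (rule image_cong[OF refl])
    fix i assume i: "i \<in> {1..k}"
    then have "\<pi> i \<in> {1..k}" "\<sigma> i \<in> {1..k}" "\<tau> (\<pi> i) \<in> {1..k}"
      using permutes_in_image[OF \<sigma>] permutes_in_image[OF \<tau>] permutes_in_image[OF \<pi>] by blast+
    \<comment> \<open>The image is again one of the roots of U and thus positive, so
      \<open>abs_root\<close> leaves it unchanged.\<close>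
    with i show "abs_root (2 * k) (block_perm k (\<sigma>, \<tau>) (vroot k i (\<pi> i))) = vroot k (\<sigma> i) (\<tau> (\<pi> i))"
      using block_perm_vroot[OF \<sigma> \<tau> i] by (simp add: abs_root_def vroot_pos_roots)
  qed
  also have "\<dots> = (\<lambda>i. vroot k i ((\<tau> \<circ> \<pi> \<circ> inv' \<sigma>) i)) ` \<sigma> ` {1..k}"
    by (simp add: image_image permutes_inverses[OF \<sigma>])
  also have "\<sigma> ` {1..k} = {1..k}"
    by (rule permutes_image[OF \<sigma>])
  finally show ?thesis
    by (simp add: Rset_def)
qed

abbreviation levi_act :: "nat \<Rightarrow> (real vec \<Rightarrow> real vec) \<Rightarrow> real vec set \<Rightarrow> real vec set" where
  "levi_act k w \<equiv> restrict (std_act (2 * k) w) (Omega (vroots k))"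

lemma levi_act_Rset:
  assumes \<sigma>: "\<sigma> permutes {1..k}" and \<tau>: "\<tau> permutes {1..k}" and \<pi>: "\<pi> permutes {1..k}"
  shows "levi_act k (block_perm k (\<sigma>, \<tau>)) (Rset k \<pi>) = Rset k (\<tau> \<circ> \<pi> \<circ> inv' \<sigma>)"
  using std_act_Rset[OF assms] \<pi> by (simp add: Omega_vroots)

text \<open>Sending \<pi> to \<open>\<tau> \<circ> \<pi> \<circ> inv' \<sigma>\<close> is a left
  action because inversion reverses products in \<sigma>. The laws are verified on pairs (\<sigma>,
  \<tau>), and bijectivity follows from the pair of inverses.\<close>

lemma group_action_levi: "group_action (levi k) (Omega (vroots k)) (levi_act k)"
proof -
  let ?\<Omega> = "Omega (vroots k)"
  have closed: "levi_act k (block_perm k (\<sigma>, \<tau>)) R \<in> ?\<Omega>"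
    if p: "\<sigma> permutes {1..k}" "\<tau> permutes {1..k}" and R: "R \<in> ?\<Omega>" for \<sigma> \<tau> R
  proof -
    obtain \<pi> where \<pi>: "\<pi> permutes {1..k}" "R = Rset k \<pi>"
      using R by (auto simp: Omega_vroots)
    have "\<tau> \<circ> \<pi> \<circ> inv' \<sigma> permutes {1..k}"
      using p \<pi> by (intro permutes_compose permutes_inv)
    then show ?thesis
      using levi_act_Rset[OF p \<pi>(1)] \<pi>(2) by (simp add: Omega_vroots)
  qed
  have comp: "levi_act k (block_perm k (\<sigma> \<circ> \<sigma>', \<tau> \<circ> \<tau>')) R =
      levi_act k (block_perm k (\<sigma>, \<tau>)) (levi_act k (block_perm k (\<sigma>', \<tau>')) R)"
    if p: "\<sigma> permutes {1..k}" "\<tau> permutes {1..k}" "\<sigma>' permutes {1..k}" "\<tau>' permutes {1..k}"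
      and R: "R \<in> ?\<Omega>" for \<sigma> \<tau> \<sigma>' \<tau>' R
  proof -
    obtain \<pi> where \<pi>: "\<pi> permutes {1..k}" "R = Rset k \<pi>"
      using R by (auto simp: Omega_vroots)
    have "\<tau>' \<circ> \<pi> \<circ> inv' \<sigma>' permutes {1..k}"
      using p \<pi> by (intro permutes_compose permutes_inv)
    then show ?thesis
      unfolding \<pi>(2) levi_act_Rset[OF p(3,4) \<pi>(1)]
        levi_act_Rset[OF permutes_compose[OF p(3,1)] permutes_compose[OF p(4,2)] \<pi>(1)]
      by (simp only: levi_act_Rset[OF p(1,2)] comp_assoc
          o_inv_distrib[OF permutes_bij[OF p(1)] permutes_bij[OF p(3)]])
  qed
  have one: "levi_act k (block_perm k (id, id)) R = R" if "R \<in> ?\<Omega>" for R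
    using that levi_act_Rset[OF permutes_id permutes_id] by (auto simp: Omega_vroots)
  have Bij: "levi_act k (block_perm k (\<sigma>, \<tau>)) \<in> Bij ?\<Omega>"
    if p: "\<sigma> permutes {1..k}" "\<tau> permutes {1..k}" for \<sigma> \<tau>
  proof -
    note p' = permutes_inv[OF p(1)] permutes_inv[OF p(2)]
    have "bij_betw (levi_act k (block_perm k (\<sigma>, \<tau>))) ?\<Omega> ?\<Omega>"
    proof (rule bij_betw_byWitness[where f' = "levi_act k (block_perm k (inv' \<sigma>, inv' \<tau>))"])
      show "\<forall>R\<in>?\<Omega>. levi_act k (block_perm k (inv' \<sigma>, inv' \<tau>))
          (levi_act k (block_perm k (\<sigma>, \<tau>)) R) = R"
        using comp[OF p' p, symmetric] one permutes_inv_o[OF p(1)] permutes_inv_o[OF p(2)] by simp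
      show "\<forall>R\<in>?\<Omega>. levi_act k (block_perm k (\<sigma>, \<tau>))
          (levi_act k (block_perm k (inv' \<sigma>, inv' \<tau>)) R) = R"
        using comp[OF p p', symmetric] one permutes_inv_o[OF p(1)] permutes_inv_o[OF p(2)] by simp
    qed (use closed[OF p] closed[OF p'] in blast)+
    then show ?thesis
      by (simp add: Bij_def)
  qed
  have "levi_act k \<in> hom (levi k) (BijGroup ?\<Omega>)"
  proof (rule homI)
    fix v assume "v \<in> carrier (levi k)"
    then obtain \<sigma> \<tau> where v: "v = block_perm k (\<sigma>, \<tau>)" "\<sigma> permutes {1..k}" "\<tau> permutes {1..k}"
      by (force simp: carrier_levi sym_group_carrier)
    then show "levi_act k v \<in> carrier (BijGroup ?\<Omega>)"
      using Bij by (simp add: BijGroup_def)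
    fix w assume "w \<in> carrier (levi k)"
    then obtain \<sigma>' \<tau>' where w: "w = block_perm k (\<sigma>', \<tau>')" "\<sigma>' permutes {1..k}" "\<tau>' permutes {1..k}"
      by (force simp: carrier_levi sym_group_carrier)
    have "v \<otimes>\<^bsub>levi k\<^esub> w = block_perm k (\<sigma> \<circ> \<sigma>', \<tau> \<circ> \<tau>')"
      unfolding v(1) w(1) mult_levi block_perm_comp[OF v(2,3) w(2,3)] ..
    moreover have "levi_act k (block_perm k (\<sigma> \<circ> \<sigma>', \<tau> \<circ> \<tau>')) =
        compose ?\<Omega> (levi_act k v) (levi_act k w)"
    proof
      fix R
      show "levi_act k (block_perm k (\<sigma> \<circ> \<sigma>', \<tau> \<circ> \<tau>')) R =
          compose ?\<Omega> (levi_act k v) (levi_act k w) R"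
      proof (cases "R \<in> ?\<Omega>")
        case True
        then show ?thesis
          using comp[OF v(2,3) w(2,3) True] by (simp only: compose_eq v(1) w(1))
      qed (simp add: compose_def)
    qed
    ultimately show "levi_act k (v \<otimes>\<^bsub>levi k\<^esub> w) =
        levi_act k v \<otimes>\<^bsub>BijGroup ?\<Omega>\<^esub> levi_act k w"
      using Bij v w by (simp add: BijGroup_def)
  qed
  then show ?thesis
    using group_levi group_BijGroup
    by (intro group_action.intro group_hom.intro group_hom_axioms.intro)
qed

section \<open>Reflections of W_I and the quasiparabolic conditions\<close>

lemma conjugate_transpose:
  assumes "bij f"
  shows "f \<circ> transpose a b \<circ> inv' f = transpose (f a) (f b)"
proof -
  have "transpose (f a) (f b) \<circ> f = f \<circ> transpose a b"
    using transpose_comp_eq[OF assms, of "f a" "f b"] assms by (simp add: bij_is_inj)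
  then have "f \<circ> transpose a b \<circ> inv' f = transpose (f a) (f b) \<circ> (f \<circ> inv' f)"
    by (simp only: comp_assoc[symmetric])
  moreover have "f \<circ> inv' f = id"
    using bij_is_surj[OF assms] surj_iff by blast
  ultimately show ?thesis
    by simp
qed

text \<open>Conjugation in a direct product acts on each factor separately, so a conjugate of a
  generator is a transposition in one block and trivial in the other.\<close>

lemma reflections_levi_cases:
  assumes "r \<in> reflections (levi k) (levi_refls k)"
  obtains a b where "a \<in> {1..k}" "b \<in> {1..k}" "a \<noteq> b" "r = block_perm k (transpose a b, id)"
  | a b where "a \<in> {1..k}" "b \<in> {1..k}" "a \<noteq> b" "r = block_perm k (id, transpose a b)"
proof -
  interpret h: group_hom "sym_prod k" "levi k" "block_perm k"
    using group_sym_prod group_levi block_perm_iso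
    by (intro group_hom.intro group_hom_axioms.intro) (auto simp: iso_def)
  obtain w s where w: "w \<in> carrier (levi k)" and s: "s \<in> levi_refls k"
    and r: "r = w \<otimes>\<^bsub>levi k\<^esub> s \<otimes>\<^bsub>levi k\<^esub> m_inv (levi k) w"
    using assms by (auto simp: reflections_def)
  obtain \<sigma> \<tau> where w_eq: "w = block_perm k (\<sigma>, \<tau>)"
    and \<sigma>: "\<sigma> permutes {1..k}" and \<tau>: "\<tau> permutes {1..k}"
    using w by (force simp: carrier_levi sym_group_carrier)
  have conj: "w \<otimes>\<^bsub>levi k\<^esub> block_perm k (x, y) \<otimes>\<^bsub>levi k\<^esub> m_inv (levi k) w =
      block_perm k (\<sigma> \<circ> x \<circ> inv' \<sigma>, \<tau> \<circ> y \<circ> inv' \<tau>)"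
    if "x permutes {1..k}" "y permutes {1..k}" for x y
  proof -
    have c: "(\<sigma>, \<tau>) \<in> carrier (sym_prod k)" "(x, y) \<in> carrier (sym_prod k)"
      using \<sigma> \<tau> that by (simp_all only: carrier_sym_prod simp_thms)
    have "w \<otimes>\<^bsub>levi k\<^esub> block_perm k (x, y) \<otimes>\<^bsub>levi k\<^esub> m_inv (levi k) w =
        block_perm k ((\<sigma>, \<tau>) \<otimes>\<^bsub>sym_prod k\<^esub> (x, y) \<otimes>\<^bsub>sym_prod k\<^esub> m_inv (sym_prod k) (\<sigma>, \<tau>))"
      using c by (simp only: w_eq h.hom_mult h.hom_inv h.G.m_closed h.G.inv_closed)
    also have "m_inv (sym_prod k) (\<sigma>, \<tau>) = (inv' \<sigma>, inv' \<tau>)"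
      using inv_DirProd[OF sym_group_is_group sym_group_is_group] \<sigma> \<tau>
      by (simp add: sym_group_carrier)
    finally show ?thesis
      by (simp add: sym_group_mult)
  qed
  have image: "\<sigma> i \<in> {1..k}" "\<sigma> (Suc i) \<in> {1..k}" "\<sigma> i \<noteq> \<sigma> (Suc i)"
    "\<tau> i \<in> {1..k}" "\<tau> (Suc i) \<in> {1..k}" "\<tau> i \<noteq> \<tau> (Suc i)" "transpose i (Suc i) permutes {1..k}"
    if "1 \<le> i" "i < k" for i
    using that permutes_in_image[OF \<sigma>] permutes_in_image[OF \<tau>]
      permutes_inj[OF \<sigma>] permutes_inj[OF \<tau>]
    by (simp_all add: inj_eq permutes_swap_id)
  from s show ?thesis
  proof (cases rule: levi_refls_cases)
    case (1 i)
    then have "r = block_perm k (transpose (\<sigma> i) (\<sigma> (Suc i)), id)"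
      using r conj[of "transpose i (Suc i)" id] image(7)
      by (simp add: conjugate_transpose permutes_bij[OF \<sigma>] permutes_id permutes_inv_o[OF \<tau>])
    then show ?thesis
      using that(1) image(1-3) 1 by blast
  next
    case (2 i)
    then have "r = block_perm k (id, transpose (\<tau> i) (\<tau> (Suc i)))"
      using r conj[of id "transpose i (Suc i)"] image(7)
      by (simp add: conjugate_transpose permutes_bij[OF \<tau>] permutes_id permutes_inv_o[OF \<sigma>])
    then show ?thesis
      using that(2) image(4-6) 2 by blast
  qed
qed

text \<open>A reflection of the second block swaps the values a and b of \<pi>, which is the same as
  swapping the positions where they occur. Both kinds thus take one form, with positions that may
  depend on \<pi>.\<close>

lemma reflection_act:
  assumes r: "r \<in> reflections (levi k) (levi_refls k)" and \<pi>: "\<pi> permutes {1..k}"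
  obtains a b where "a \<in> {1..k}" "b \<in> {1..k}" "a < b"
    "levi_act k r (Rset k \<pi>) = Rset k (\<pi> \<circ> transpose a b)"
proof -
  have "\<exists>a b. a \<in> {1..k} \<and> b \<in> {1..k} \<and> a \<noteq> b \<and>
      levi_act k r (Rset k \<pi>) = Rset k (\<pi> \<circ> transpose a b)"
    using r
  proof (cases rule: reflections_levi_cases)
    case (1 a b)
    then have "levi_act k r (Rset k \<pi>) = Rset k (\<pi> \<circ> transpose a b)"
      using levi_act_Rset[OF permutes_swap_id permutes_id \<pi>, of a b] by simp
    then show ?thesis using 1 by blast
  next
    case (2 a b)
    let ?a = "inv' \<pi> a" and ?b = "inv' \<pi> b"
    have "levi_act k r (Rset k \<pi>) = Rset k (transpose a b \<circ> \<pi>)"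
      using levi_act_Rset[OF permutes_id permutes_swap_id \<pi>, of a b] 2 by simp
    then have "levi_act k r (Rset k \<pi>) = Rset k (\<pi> \<circ> transpose ?a ?b)"
      by (simp add: transpose_comp_eq[OF permutes_bij[OF \<pi>]])
    moreover have "?a \<in> {1..k}" "?b \<in> {1..k}" "?a \<noteq> ?b"
      using 2 permutes_in_image[OF permutes_inv[OF \<pi>]] permutes_inj[OF permutes_inv[OF \<pi>]]
      by (simp_all add: inj_eq)
    ultimately show ?thesis by blast
  qed
  then obtain a b where "a \<in> {1..k}" "b \<in> {1..k}" "a \<noteq> b"
    "levi_act k r (Rset k \<pi>) = Rset k (\<pi> \<circ> transpose a b)" by blast
  then show ?thesis
    using that[of a b] that[of b a] by (metis nat_neq_iff transpose_commute)
qed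

text \<open>Here left and right multiplication stay apart, since adjacent values need not occur at
  adjacent positions. The index i is uniform in \<pi> because (QP2) applies the same s to \<pi> and
  to \<open>\<pi> \<circ> transpose a b\<close>.\<close>

lemma levi_refls_act:
  assumes "s \<in> levi_refls k"
  obtains i where "1 \<le> i" "i < k"
    "\<And>\<pi>. \<pi> permutes {1..k} \<Longrightarrow> levi_act k s (Rset k \<pi>) = Rset k (\<pi> \<circ> transpose i (Suc i))"
  | i where "1 \<le> i" "i < k"
    "\<And>\<pi>. \<pi> permutes {1..k} \<Longrightarrow> levi_act k s (Rset k \<pi>) = Rset k (transpose i (Suc i) \<circ> \<pi>)"
  using assms
proof (cases rule: levi_refls_cases)
  case (1 i)
  then have "transpose i (Suc i) permutes {1..k}"
    by (intro permutes_swap_id) auto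
  from levi_act_Rset[OF this permutes_id] show ?thesis
    using that(1)[of i] 1 by simp
next
  case (2 i)
  then have "transpose i (Suc i) permutes {1..k}"
    by (intro permutes_swap_id) auto
  from levi_act_Rset[OF permutes_id this] show ?thesis
    using that(2)[of i] 2 by simp
qed

lemma transpose_adjacent_less:
  fixes x y :: nat
  assumes "x < y" "transpose i (Suc i) y < transpose i (Suc i) x"
  shows "x = i \<and> y = Suc i"
  using assms by (auto simp: transpose_def split: if_splits)

text \<open>The assumption \<open>up\<close> means \<pi> a < \<pi> b, and a drop after applying the
  adjacent transposition means that it has reversed a pair: the positions a, b when acting on the
  right, the values \<pi> a, \<pi> b when acting on the left. That pair must be i, Suc i, and then
  both products coincide.\<close>

lemma QP2_transpose:
  assumes \<pi>: "\<pi> permutes {1..k}" and ab: "a \<in> {1..k}" "b \<in> {1..k}" "a < b"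
    and up: "card (inversions \<pi>) < card (inversions (\<pi> \<circ> transpose a b))"
    and i: "1 \<le> i" "i < k"
  shows "card (inversions (\<pi> \<circ> transpose a b \<circ> transpose i (Suc i))) <
      card (inversions (\<pi> \<circ> transpose i (Suc i))) \<Longrightarrow> \<pi> \<circ> transpose a b = \<pi> \<circ> transpose i (Suc i)"
    and "card (inversions (transpose i (Suc i) \<circ> (\<pi> \<circ> transpose a b))) <
      card (inversions (transpose i (Suc i) \<circ> \<pi>)) \<Longrightarrow> \<pi> \<circ> transpose a b = transpose i (Suc i) \<circ> \<pi>"
proof -
  let ?s = "transpose i (Suc i)" and ?t = "transpose a b"
  have s: "?s permutes {1..k}"
    using i by (intro permutes_swap_id) auto
  note iff = card_inversions_transpose_iff[where m = 1 and n = "Suc k",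
      unfolded atLeastLessThanSuc_atLeastAtMost]
  have less: "\<pi> a < \<pi> b"
    using up iff(1)[OF \<pi> ab(3,1,2)] by simp
  {
    assume down: "card (inversions (\<pi> \<circ> ?t \<circ> ?s)) < card (inversions (\<pi> \<circ> ?s))"
    have \<pi>s: "\<pi> \<circ> ?s permutes {1..k}"
      by (rule permutes_compose[OF s \<pi>])
    have sa: "?s a \<in> {1..k}" "?s b \<in> {1..k}"
      using ab permutes_in_image[OF s] by blast+
    \<comment> \<open>Moving \<open>?s\<close> to the left turns \<open>?t\<close> into the swap of
      \<open>?s a\<close> and \<open>?s b\<close>, where \<open>\<pi> \<circ> ?s\<close> has the
      values \<pi> a < \<pi> b. A drop is then possible only if these positions come in reversed
      order.\<close>
    have "?t \<circ> ?s = ?s \<circ> transpose (?s a) (?s b)"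
      using transpose_comp_eq[of ?s a b] by simp
    then have "\<pi> \<circ> ?t \<circ> ?s = \<pi> \<circ> ?s \<circ> transpose (?s a) (?s b)"
      by (simp only: comp_assoc)
    then have "\<not> ?s a < ?s b"
      using down less iff(2)[OF \<pi>s _ sa] by auto
    moreover have "?s a \<noteq> ?s b"
      using ab(3) by (metis less_irrefl transpose_involutory)
    ultimately have "?s b < ?s a"
      by linarith
    from transpose_adjacent_less[OF ab(3) this] show "\<pi> \<circ> ?t = \<pi> \<circ> ?s"
      by (simp only:)
  next
    assume down: "card (inversions (?s \<circ> (\<pi> \<circ> ?t))) < card (inversions (?s \<circ> \<pi>))"
    have "?s \<circ> \<pi> permutes {1..k}"
      by (rule permutes_compose[OF \<pi> s])
    from iff(2)[OF this ab(3,1,2)] down have "?s (\<pi> b) < ?s (\<pi> a)"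
      by (simp add: comp_assoc)
    from transpose_adjacent_less[OF less this] have "\<pi> a = i" "\<pi> b = Suc i"
      by blast+
    then have "inv' \<pi> i = a" "inv' \<pi> (Suc i) = b"
      using permutes_inverses(2)[OF \<pi>] by metis+
    then show "\<pi> \<circ> ?t = ?s \<circ> \<pi>"
      by (simp add: transpose_comp_eq[OF permutes_bij[OF \<pi>]])
  }
qed

lemma card_inversions_left_adjacent_cases:
  assumes \<pi>: "\<pi> permutes {1..k}" and i: "1 \<le> i" "i < k"
  shows "card (inversions (transpose i (Suc i) \<circ> \<pi>)) = Suc (card (inversions \<pi>)) \<or>
    card (inversions \<pi>) = Suc (card (inversions (transpose i (Suc i) \<circ> \<pi>)))"
proof -
  let ?s = "transpose i (Suc i)"
  have "?s \<circ> \<pi> permutes {1..k}"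
    using i by (intro permutes_compose[OF \<pi>] permutes_swap_id) auto
  then have "card (inversions (?s \<circ> \<pi>)) = card (inversions (inv' (?s \<circ> \<pi>)))"
    by (rule card_inversions_inv[symmetric])
  also have "inv' (?s \<circ> \<pi>) = inv' \<pi> \<circ> ?s"
    using o_inv_distrib[of ?s \<pi>] permutes_bij[OF \<pi>] by simp
  finally show ?thesis
    using card_inversions_adjacent_cases[of "inv' \<pi>" 1 "Suc k" i] permutes_inv[OF \<pi>] i
      card_inversions_inv[OF \<pi>]
    by (simp add: atLeastLessThanSuc_atLeastAtMost o_def)
qed

lemma quasiparabolic_levi:
  "quasiparabolic (levi k) (levi_refls k) (levi_act k) (Omega (vroots k))
    (\<lambda>R. int (rho (2 * k) (vroots k) R))"
proof -
  let ?lev = "\<lambda>R. int (rho (2 * k) (vroots k) R)"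
  have lev: "?lev (Rset k \<pi>) = int (card (inversions \<pi>))" if "\<pi> permutes {1..k}" for \<pi>
    using rho_Rset[OF that] by simp
  have scaled: "\<bar>?lev (levi_act k s R) - ?lev R\<bar> \<le> 1"
    if s: "s \<in> levi_refls k" and R: "R \<in> Omega (vroots k)" for s R
  proof -
    obtain \<pi> where \<pi>: "\<pi> permutes {1..k}" "R = Rset k \<pi>"
      using R by (auto simp: Omega_vroots)
    from s show ?thesis
    proof (cases rule: levi_refls_act)
      case (1 i)
      then have "\<pi> \<circ> transpose i (Suc i) permutes {1..k}"
        using \<pi> by (intro permutes_compose permutes_swap_id) auto
      then show ?thesis
        using card_inversions_adjacent_cases[of \<pi> 1 "Suc k" i] 1 \<pi>
        by (auto simp: lev atLeastLessThanSuc_atLeastAtMost)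
    next
      case (2 i)
      then have "transpose i (Suc i) \<circ> \<pi> permutes {1..k}"
        using \<pi> by (intro permutes_compose permutes_swap_id) auto
      then show ?thesis
        using card_inversions_left_adjacent_cases[of \<pi> k i] 2 \<pi> by (auto simp: lev)
    qed
  qed
  have QP1: "levi_act k r R = R"
    if r: "r \<in> reflections (levi k) (levi_refls k)" and R: "R \<in> Omega (vroots k)"
      and eq: "?lev (levi_act k r R) = ?lev R" for r R
  proof -
    obtain \<pi> where \<pi>: "\<pi> permutes {1..k}" "R = Rset k \<pi>"
      using R by (auto simp: Omega_vroots)
    obtain a b where ab: "a \<in> {1..k}" "b \<in> {1..k}" "a < b"
      "levi_act k r R = Rset k (\<pi> \<circ> transpose a b)"
      using reflection_act[OF r \<pi>(1)] \<pi>(2) by metis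
    have \<pi>t: "\<pi> \<circ> transpose a b permutes {1..k}"
      using \<pi> ab by (intro permutes_compose permutes_swap_id)
    have "card (inversions (\<pi> \<circ> transpose a b)) = card (inversions \<pi>)"
      using eq unfolding ab(4) unfolding \<pi>(2) lev[OF \<pi>t] lev[OF \<pi>(1)] by simp
    \<comment> \<open>Distinct values make the level change strictly, so the premise of (QP1) is
      never met.\<close>
    moreover have "\<pi> a \<noteq> \<pi> b"
      using permutes_inj[OF \<pi>(1)] ab(3) by (simp add: inj_eq)
    ultimately show ?thesis
      using card_inversions_transpose_iff[of \<pi> 1 "Suc k" a b] \<pi>(1) ab
      by (auto simp: atLeastLessThanSuc_atLeastAtMost)
  qed
  have QP2: "levi_act k r R = levi_act k s R"
    if r: "r \<in> reflections (levi k) (levi_refls k)" and s: "s \<in> levi_refls k"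
      and R: "R \<in> Omega (vroots k)"
      and up: "?lev (levi_act k r R) > ?lev R"
      and down: "?lev (levi_act k s (levi_act k r R)) < ?lev (levi_act k s R)" for r s R
  proof -
    obtain \<pi> where \<pi>: "\<pi> permutes {1..k}" "R = Rset k \<pi>"
      using R by (auto simp: Omega_vroots)
    obtain a b where ab: "a \<in> {1..k}" "b \<in> {1..k}" "a < b"
      and act_r: "levi_act k r R = Rset k (\<pi> \<circ> transpose a b)"
      using reflection_act[OF r \<pi>(1)] \<pi>(2) by metis
    have \<pi>t: "\<pi> \<circ> transpose a b permutes {1..k}"
      using \<pi> ab by (intro permutes_compose permutes_swap_id)
    have up': "card (inversions \<pi>) < card (inversions (\<pi> \<circ> transpose a b))"
      using up unfolding act_r unfolding \<pi>(2) lev[OF \<pi>t] lev[OF \<pi>(1)] by simp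
    from s show ?thesis
    proof (cases rule: levi_refls_act)
      case (1 i)
      have s: "transpose i (Suc i) permutes {1..k}"
        using 1 by (intro permutes_swap_id) auto
      have "card (inversions (\<pi> \<circ> transpose a b \<circ> transpose i (Suc i))) <
          card (inversions (\<pi> \<circ> transpose i (Suc i)))"
        using down unfolding act_r unfolding \<pi>(2) 1(3)[OF \<pi>t] 1(3)[OF \<pi>(1)]
          lev[OF permutes_compose[OF s \<pi>t]] lev[OF permutes_compose[OF s \<pi>(1)]] by simp
      from QP2_transpose(1)[OF \<pi>(1) ab up' 1(1,2) this] show ?thesis
        unfolding act_r unfolding \<pi>(2) 1(3)[OF \<pi>(1)] by simp
    next
      case (2 i)
      have s: "transpose i (Suc i) permutes {1..k}"
        using 2 by (intro permutes_swap_id) auto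
      have "card (inversions (transpose i (Suc i) \<circ> (\<pi> \<circ> transpose a b))) <
          card (inversions (transpose i (Suc i) \<circ> \<pi>))"
        using down unfolding act_r unfolding \<pi>(2) 2(3)[OF \<pi>t] 2(3)[OF \<pi>(1)]
          lev[OF permutes_compose[OF \<pi>t s]] lev[OF permutes_compose[OF \<pi>(1) s]] by simp
      from QP2_transpose(2)[OF \<pi>(1) ab up' 2(1,2) this] show ?thesis
        unfolding act_r unfolding \<pi>(2) 2(3)[OF \<pi>(1)] by simp
    qed
  qed
  show ?thesis
    unfolding quasiparabolic_def scaled_set_def
    using group_action_levi scaled QP1 QP2 by blast
qed

lemma QP_triple_levi: "QP_triple (2 * k) (levi_refls k) (vroots k)"
  unfolding QP_triple_def
  using quasiparabolic_levi vroots_pos_roots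
  by (auto simp: levi_refls_def simple_refls_def)

theorem theorem3p13:
  fixes n k :: nat
    and I :: "(real vec \<Rightarrow> real vec) set"
    and U :: "real vec set"
  assumes "n = 2 * k" and "n \<ge> 4"
    and "I = simple_refls n - {simple_refl n k, simple_refl n (2 * k)}"
    and "U = {vroot k i j | i j. i \<in> {1..k} \<and> j \<in> {1..k}}"
  shows
    "parabolic_D n I \<cong> sym_group k \<times>\<times> sym_group k \<and>
     QP_triple n I U \<and>
     card (Omega U) = fact k \<and> (\<forall>R\<in>Omega U. \<exists>\<pi>. \<pi> permutes {1..k} \<and> R = Rset k \<pi>) \<and>
     (\<forall>\<pi>. \<pi> permutes {1..k} \<longrightarrow>
           Res n U (Rset k \<pi>) =
             {vroot k i j | i j. i \<in> {1..k} \<and> j \<in> {1..k} \<and> \<pi> i > j \<and> inv' \<pi> j > i}) \<and>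
     (\<forall>\<pi>. \<pi> permutes {1..k} \<longrightarrow>
           {(i, j). i \<in> {1..k} \<and> j \<in> {1..k} \<and> vroot k i j \<in> Res n U (Rset k \<pi>)} =
             rothe_diagram k \<pi>) \<and>
     (\<forall>\<pi>. \<pi> permutes {1..k} \<longrightarrow> rho n U (Rset k \<pi>) = perm_length k \<pi>) \<and>
     QHf n U =
           (\<Sum>\<pi> | \<pi> permutes {1..k}. qvar ^ perm_length k \<pi> * (\<Prod>i = 1..k. xvar (vroot k i (\<pi> i)))) \<and>
     QHf n U = q_permanent qvar (vmat k) \<and>
     QPf n U =
           (\<Sum>\<pi> | \<pi> permutes {1..k}. (- qvar) ^ perm_length k \<pi> * (\<Prod>i = 1..k. xvar (vroot k i (\<pi> i)))) \<and>
     QPf n U = quantum_row_permanent qvar (vmat k) \<and>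
     Hf n U = permanent (vmat k) \<and>
     Pf n U = det (vmat k) \<and>
     PS n U = (\<Prod>i = 2..k. q_int i) \<and>
     is_degrees n U (mset [2..<k + 1])"
proof -
  have k: "2 \<le> k"
    using assms(1,2) by simp
  have U: "U = vroots k"
    using assms(4) by (simp add: vroots_def)
  have I: "I = levi_refls k"
    using levi_refls_eq_Diff[OF k] assms(1,3) by simp
  have "card (Omega (vroots k)) = fact k"
    unfolding Omega_vroots card_image[OF Rset_inj_on] by (simp add: card_permutations)
  moreover have "\<forall>R\<in>Omega (vroots k). \<exists>\<pi>. \<pi> permutes {1..k} \<and> R = Rset k \<pi>"
    by (auto simp: Omega_vroots)
  moreover have "\<forall>\<pi>. \<pi> permutes {1..k} \<longrightarrow> rho (2 * k) (vroots k) (Rset k \<pi>) = perm_length k \<pi>"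
    by (simp add: rho_Rset perm_length_eq_inversions)
  moreover have "QHf (2 * k) (vroots k) =
      (\<Sum>\<pi> | \<pi> permutes {1..k}. qvar ^ perm_length k \<pi> * (\<Prod>i = 1..k. xvar (vroot k i (\<pi> i))))"
    unfolding QHf_vroots by (rule sum.cong) (simp_all add: perm_length_eq_inversions)
  moreover have "QPf (2 * k) (vroots k) =
      (\<Sum>\<pi> | \<pi> permutes {1..k}. (- qvar) ^ perm_length k \<pi> * (\<Prod>i = 1..k. xvar (vroot k i (\<pi> i))))"
    unfolding QPf_vroots by (rule sum.cong) (simp_all add: perm_length_eq_inversions)
  moreover have "QHf (2 * k) (vroots k) = q_permanent qvar (vmat k)"
    unfolding QHf_vroots q_permanent_vmat ..
  moreover have "QPf (2 * k) (vroots k) = quantum_row_permanent qvar (vmat k)"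
    unfolding QPf_vroots quantum_row_permanent_eq q_permanent_vmat ..
  moreover have "Hf (2 * k) (vroots k) = permanent (vmat k)"
    unfolding Hf_vroots permanent_vmat ..
  moreover have "Pf (2 * k) (vroots k) = det (vmat k)"
    unfolding Pf_vroots det_vmat ..
  ultimately show ?thesis
    unfolding I U assms(1)
    by (intro conjI)
      (assumption | rule levi_iso QP_triple_levi PS_vroots is_degrees_vroots allI impI
        Res_vroots Res_eq_rothe_diagram)+
qed

end
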